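(* Let $(X,\|\cdot\|)$ be a reflexive Banach space with dual $(X^*,\|\cdot\|_* )$. For each $n\in\mathbb N$ let $f_n:X\to(-\infty,+\infty]$ be a proper, lower semicontinuous, and convex functional, and let $f:X\to(-\infty,+\infty]$ be proper, such that i) for all $N>0$, $$\lim_{\|\xi\|_*\to+\infty}\frac{1}{\|\xi\|_*}\Big(\inf_{n\le N}f_n^*(\xi)\Big)=\infty,\qquad \lim_{\|v\|\to+\infty}\frac{1}{\|v\|}\Big(\inf_{n\le N}f_n(v)\Big)=\infty;$$ ii) $f_n$ converges to $f$ in the sense of Mosco. Let $\varepsilon\in(0,1]$ and $p>1$, let $p^*>1$ be the conjugate exponent of $p$, and let $f_n^\varepsilon$ and $f^\varepsilon$ denote the $p$-Moreau--Yosida regularizations of $f_n$ and $f$ with parameter $\varepsilon$. Then: (1) The regularizations satisfy i) and ii), that is: for all $N>0$, $$\lim_{\|\xi\|_*\to+\infty}\frac{1}{\|\xi\|_*}\Big(\inf_{n\le N}f_n^{\varepsilon,*}(\xi)\Big)=\infty,\qquad \lim_{\|v\|\to+\infty}\frac{1}{\|v\|}\Big(\inf_{n\le N}f_n^{\varepsilon}(v)\Big)=\infty,$$ and $f_n^\varepsilon$ converges to $f^\varepsilon$ in the sense of Mosco as $n\to\infty$. (2) The convex conjugate $f_n^{\varepsilon,*}$ of $f_n^\varepsilon$ is given by $$f_n^{\varepsilon,*}(\xi)=\frac{\varepsilon}{p^*}\|\xi\|_*^{p^*}+f_n^*(\xi)\qquad\text{for all }\xi\in X^*,\ n\in\mathbb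 N.$$ (3) $f_n^\varepsilon$ and $f_n^{\varepsilon,*}$ are superlinear uniformly with respect to $\varepsilon$, that is: for all $N>0$ and $M>0$ there exists $K>0$ such that for all $\varepsilon\in(0,1]$ and all $n\le N$, $f_n^\varepsilon(v)\ge M\|v\|$ for all $v\in X$ with $\|v\|\ge K$, and $f_n^{\varepsilon,*}(\xi)\ge M\|\xi\|_*$ for all $\xi\in X^*$ with $\|\xi\|_*\ge K$. (4) For every sequence $(\varepsilon_n)_{n\in\mathbb N}\subset(0,1]$ with $\varepsilon_n\to0$ as $n\to\infty$, the sequence $f_n^{\varepsilon_n}$ converges to $f$ in the sense of Mosco.
   Context: Spaces are real; $\langle\cdot,\cdot\rangle$ is the duality pairing between $X^*$ and $X$. A functional $g:X\to(-\infty,+\infty]$ is proper if it is not identically $+\infty$. Its convex conjugate (Legendre--Fenchel transform) is $g^*(\xi)=\sup_{v\in X}\{\langle\xi,v\rangle-g(v)\}$, $\xi\in X^*$. For $\varepsilon>0$ and $p>1$ the $p$-Moreau--Yosida regularization of $g$ is $$g^\varepsilon(u)=\inf_{v\in X}\left\{\frac{\varepsilon}{p}\left\|\frac{u-v}{\varepsilon}\right\|^p+g(v)\right\},\qquad u\in X,$$ and $g^{\varepsilon,*}:=(g^\varepsilon)^*$. Mosco convergence: $g_n$ converges to $g$ in the sense of Mosco if for every $u\in X$: (a) $g(u)\le\liminf_{n\to\infty}g_n(u_n)$ for every sequence $u_n\rightharpoonup u$ weakly in $X$; and (b) there exists a sequence $\hat u_n\to u$ strongly in $X$ such that $g(u)\ge\limsup_{n\to\infty}g_n(\hat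 u_n)$. *)

theory Defs
  imports "HOL-Analysis.Analysis"
begin

text \<open>
  The topological dual of \<open>'a\<close> is the type \<open>'a \<Rightarrow>\<^sub>L real\<close>; its norm is the operator norm, that is
  the dual norm, and \<open>blinfun_apply \<xi> v\<close> is the duality pairing. Functionals with values in
  \<open>(-\<infinity>, +\<infinity>]\<close> are functions into \<open>ereal\<close> that avoid \<open>-\<infinity>\<close>; this requirement is part of
  \<open>proper_functional\<close> below.
\<close>

text \<open>Reflexivity is surjectivity of the canonical embedding \<open>x \<mapsto> (\<xi> \<mapsto> \<xi> x)\<close> into the bidual.\<close>

definition reflexive_space :: "'a::real_normed_vector itself \<Rightarrow> bool" where
  "reflexive_space _ \<longleftrightarrow>
     (\<forall>\<Phi> :: ('a \<Rightarrow>\<^sub>L real) \<Rightarrow>\<^sub>L real. \<exists>x :: 'a. \<forall>\<xi>. blinfun_apply \<Phi> \<xi> = blinfun_apply \<xi> x)"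

definition weakly_converges_to :: "(nat \<Rightarrow> 'a::real_normed_vector) \<Rightarrow> 'a \<Rightarrow> bool" where
  "weakly_converges_to u x \<longleftrightarrow>
     (\<forall>\<xi> :: 'a \<Rightarrow>\<^sub>L real. (\<lambda>n. blinfun_apply \<xi> (u n)) \<longlonglongrightarrow> blinfun_apply \<xi> x)"

definition proper_functional :: "('a \<Rightarrow> ereal) \<Rightarrow> bool" where
  "proper_functional g \<longleftrightarrow> (\<forall>v. g v \<noteq> -\<infinity>) \<and> (\<exists>v. g v \<noteq> \<infinity>)"

definition lsc_functional :: "('a::topological_space \<Rightarrow> ereal) \<Rightarrow> bool" where
  "lsc_functional g \<longleftrightarrow> (\<forall>x. g x \<le> Liminf (at x) g)"

text \<open>
  On functionals avoiding \<open>-\<infinity>\<close>, to which this is applied, the right-hand side never has the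
  form \<open>\<infinity> + (-\<infinity>)\<close>.
\<close>

definition convex_functional :: "('a::real_vector \<Rightarrow> ereal) \<Rightarrow> bool" where
  "convex_functional g \<longleftrightarrow>
     (\<forall>x y. \<forall>t::real. 0 < t \<and> t < 1 \<longrightarrow>
        g ((1 - t) *\<^sub>R x + t *\<^sub>R y) \<le> ereal (1 - t) * g x + ereal t * g y)"

definition convex_conjugate ::
    "('a::real_normed_vector \<Rightarrow> ereal) \<Rightarrow> ('a \<Rightarrow>\<^sub>L real) \<Rightarrow> ereal" where
  "convex_conjugate g \<xi> = (SUP v. ereal (blinfun_apply \<xi> v) - g v)"

definition moreau_yosida ::
    "real \<Rightarrow> real \<Rightarrow> ('a::real_normed_vector \<Rightarrow> ereal) \<Rightarrow> 'a \<Rightarrow> ereal" where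
  "moreau_yosida p \<epsilon> g u =
     (INF v. ereal (\<epsilon> / p * norm ((u - v) /\<^sub>R \<epsilon>) powr p) + g v)"

definition mosco_converges ::
    "(nat \<Rightarrow> 'a::real_normed_vector \<Rightarrow> ereal) \<Rightarrow> ('a \<Rightarrow> ereal) \<Rightarrow> bool" where
  "mosco_converges g g0 \<longleftrightarrow>
     (\<forall>u. (\<forall>w. weakly_converges_to w u \<longrightarrow> g0 u \<le> liminf (\<lambda>n. g n (w n))) \<and>
          (\<exists>w. w \<longlonglongrightarrow> u \<and> limsup (\<lambda>n. g n (w n)) \<le> g0 u))"

text \<open>
  Superlinearity of the first members of a sequence of functionals, used both on the space and on
  its dual. The filter \<open>at_infinity\<close> expresses that the norm of \<open>v\<close> tends to infinity.
\<close>

definition superlinear_upto ::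
    "nat \<Rightarrow> (nat \<Rightarrow> 'b::real_normed_vector \<Rightarrow> ereal) \<Rightarrow> bool" where
  "superlinear_upto N g \<longleftrightarrow>
     ((\<lambda>v. ereal (1 / norm v) * (INF n\<in>{..N}. g n v)) \<longlongrightarrow> \<infinity>) at_infinity"

end

theory Submission
  imports Defs "HOL-Library.Diagonal_Subsequence"
begin

text \<open>
  The regularization is the infimal convolution of the functional with \<open>x \<mapsto> (\<epsilon>/p) \<parallel>x/\<epsilon>\<parallel>\<^sup>p\<close>, whose
  conjugate is \<open>(\<epsilon>/q) \<parallel>\<xi>\<parallel>\<^sup>q\<close> by Young's inequality, and conjugation turns infimal convolution into
  addition. A Mosco convergent sequence of convex functionals is bounded below by \<open>-C (1 + \<parallel>v\<parallel>)\<close>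
  uniformly in \<open>n\<close>: otherwise convex combinations with a recovery sequence would converge strongly to
  a point of the domain of the limit while their values tend to \<open>-\<infinity>\<close>. This bound and Young's
  inequality give the superlinearity uniformly in \<open>\<epsilon>\<close>, and they keep near-minimizers \<open>v n\<close> of the
  regularization at \<open>u n\<close> bounded when \<open>u\<close> converges weakly. For fixed \<open>\<epsilon>\<close>, a subsequence of \<open>v\<close>
  converges weakly by reflexivity, and the liminf inequality passes to the infimum. For \<open>\<epsilon> n \<rightarrow> 0\<close>,
  boundedness of the penalty forces \<open>u n - v n \<rightarrow> 0\<close>, so \<open>v\<close> has the same weak limit as \<open>u\<close>.
\<close>

section \<open>The Hahn--Banach theorem\<close>

definition sublinear_functional :: "('a::real_vector \<Rightarrow> real) \<Rightarrow> bool" where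
  "sublinear_functional P \<longleftrightarrow>
     (\<forall>x y. P (x + y) \<le> P x + P y) \<and> (\<forall>c x. 0 \<le> c \<longrightarrow> P (c *\<^sub>R x) = c * P x)"

text \<open>The reverse inequality comes from the assumed one with factor \<open>1 / c\<close> at
  the point \<open>c *\<^sub>R x\<close>, so one direction for positive factors suffices.\<close>

lemma sublinear_functionalI:
  assumes add: "\<And>x y. P (x + y) \<le> P x + P y"
    and zero: "P 0 = 0"
    and scale: "\<And>c x. 0 < c \<Longrightarrow> P (c *\<^sub>R x) \<le> c * P x"
  shows "sublinear_functional P"
proof -
  have "P (c *\<^sub>R x) = c * P x" if "0 \<le> c" for c x
  proof (cases "c = 0")
    case False
    then have "c > 0" using that by simp
    have "P ((1 / c) *\<^sub>R c *\<^sub>R x) \<le> (1 / c) * P (c *\<^sub>R x)"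
      using \<open>c > 0\<close> by (intro scale) simp
    then have "c * P x \<le> P (c *\<^sub>R x)"
      using \<open>c > 0\<close> by (simp add: field_simps)
    with scale[OF \<open>c > 0\<close>, of x] show ?thesis by simp
  qed (simp add: zero)
  with add show ?thesis by (simp add: sublinear_functional_def)
qed

lemma
  assumes "sublinear_functional P"
  shows sublinear_add: "P (x + y) \<le> P x + P y"
    and sublinear_scale: "0 \<le> c \<Longrightarrow> P (c *\<^sub>R x) = c * P x"
    and sublinear_zero: "P 0 = 0"
    and sublinear_neg: "- P (- x) \<le> P x"
proof -
  show add: "P (x + y) \<le> P x + P y" for x y
    using assms by (simp add: sublinear_functional_def)
  show scale: "0 \<le> c \<Longrightarrow> P (c *\<^sub>R x) = c * P x" for c x
    using assms by (simp add: sublinear_functional_def)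
  show zero: "P 0 = 0"
    using scale[of 0 0] by simp
  show "- P (- x) \<le> P x"
    using add[of x "- x"] zero by simp
qed

text \<open>The infimum over \<open>t\<close> of \<open>Q (x + t *\<^sub>R z) - t * Q z\<close> is
  compared with its values at \<open>t = 0\<close> and, for \<open>x = - z\<close>, at
  \<open>t = 1\<close>. A pointwise minimal sublinear functional must agree with every such
  \<open>R\<close>, which makes it odd.\<close>

lemma sublinear_directional:
  fixes Q :: "'a::real_vector \<Rightarrow> real"
  assumes Q: "sublinear_functional Q"
  obtains R where "sublinear_functional R" "\<And>x. R x \<le> Q x" "R (- z) \<le> - Q z"
proof -
  define R where "R x = (INF t\<in>{0..}. Q (x + t *\<^sub>R z) - t * Q z)" for x
  \<comment> \<open>A lower bound independent of \<open>t\<close>, so the infimum is finite: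
    \<open>t * Q z\<close> is \<open>Q (t *\<^sub>R z)\<close>, and subadditivity splits off
    \<open>- x\<close>.\<close>
  have low: "- Q (- x) \<le> Q (x + t *\<^sub>R z) - t * Q z" if "t \<ge> 0" for x t
    using sublinear_add[OF Q, of "x + t *\<^sub>R z" "- x"] sublinear_scale[OF Q that] by simp
  have bdd: "bdd_below ((\<lambda>t. Q (x + t *\<^sub>R z) - t * Q z) ` {0..})" for x
    using low by (intro bdd_belowI2[where m = "- Q (- x)"]) auto
  have le: "R x \<le> Q (x + t *\<^sub>R z) - t * Q z" if "t \<ge> 0" for x t
    unfolding R_def using that by (intro cINF_lower bdd) auto
  have ge: "m \<le> R x" if "\<And>t. t \<ge> 0 \<Longrightarrow> m \<le> Q (x + t *\<^sub>R z) - t * Q z" for m x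
    unfolding R_def using that by (intro cINF_greatest) auto
  have RQ: "R x \<le> Q x" for x
    using le[of 0 x] by simp
  have "R (- z) \<le> - Q z"
    using le[of 1 "- z"] sublinear_zero[OF Q] by simp
  moreover have "sublinear_functional R"
  proof (rule sublinear_functionalI)
    show "R (x + y) \<le> R x + R y" for x y
    proof -
      \<comment> \<open>Parameters \<open>s\<close> for \<open>x\<close> and \<open>t\<close> for
        \<open>y\<close> combine to \<open>s + t\<close> for \<open>x + y\<close>; the two infima
        are then taken one after the other.\<close>
      have "R (x + y) - (Q (y + t *\<^sub>R z) - t * Q z) \<le> R x" if t: "t \<ge> 0" for t
      proof (rule ge)
        fix s :: real assume "s \<ge> 0"
        then have "R (x + y) \<le> Q ((x + y) + (s + t) *\<^sub>R z) - (s + t) * Q z"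
          using t by (intro le) auto
        also have "(x + y) + (s + t) *\<^sub>R z = (x + s *\<^sub>R z) + (y + t *\<^sub>R z)"
          by (simp add: algebra_simps)
        finally show "R (x + y) - (Q (y + t *\<^sub>R z) - t * Q z) \<le> Q (x + s *\<^sub>R z) - s * Q z"
          using sublinear_add[OF Q, of "x + s *\<^sub>R z" "y + t *\<^sub>R z"]
          by (simp add: algebra_simps)
      qed
      then have "R (x + y) - R x \<le> R y"
        by (intro ge) (simp add: algebra_simps)
      then show ?thesis by simp
    qed
    show "R 0 = 0"
      using RQ[of 0] ge[of "- Q (- 0)" 0] low[of _ 0] sublinear_zero[OF Q] by fastforce
    show "R (c *\<^sub>R x) \<le> c * R x" if c: "0 < c" for c x
    proof -
      have "R (c *\<^sub>R x) / c \<le> R x"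
      proof (rule ge)
        fix t :: real assume t: "t \<ge> 0"
        have "R (c *\<^sub>R x) \<le> Q (c *\<^sub>R x + (c * t) *\<^sub>R z) - (c * t) * Q z"
          using c t by (intro le) auto
        also have "c *\<^sub>R x + (c * t) *\<^sub>R z = c *\<^sub>R (x + t *\<^sub>R z)"
          by (simp add: algebra_simps)
        finally have "R (c *\<^sub>R x) \<le> (Q (x + t *\<^sub>R z) - t * Q z) * c"
          using c sublinear_scale[OF Q, of c "x + t *\<^sub>R z"] by (simp add: right_diff_distrib mult_ac)
        then show "R (c *\<^sub>R x) / c \<le> Q (x + t *\<^sub>R z) - t * Q z"
          using c by (simp only: pos_divide_le_eq)
      qed
      then show ?thesis using c by (simp add: field_simps)
    qed
  qed
  ultimately show ?thesis using RQ that by blast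
qed

text \<open>Zorn's lemma applies because the pointwise infimum of a nonempty chain is again
  sublinear; it is finite since every member is at least \<open>- P (- x)\<close> at
  \<open>x\<close>.\<close>

lemma minimal_sublinear_exists:
  fixes P :: "'a::real_vector \<Rightarrow> real"
  assumes P: "sublinear_functional P"
  obtains Q where "sublinear_functional Q" "\<And>x. Q x \<le> P x"
    "\<And>R. sublinear_functional R \<Longrightarrow> (\<And>x. R x \<le> Q x) \<Longrightarrow> R = Q"
proof -
  define A where "A = {Q. sublinear_functional Q \<and> (\<forall>x. Q x \<le> P x)}"
  \<comment> \<open>The order is reversed, so that the maximal element delivered by Zorn's lemma is
    minimal pointwise.\<close>
  define D where "D Q R \<longleftrightarrow> (\<forall>x. R x \<le> Q x)" for Q R :: "'a \<Rightarrow> real"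
  have "\<exists>m\<in>A. \<forall>a\<in>A. D m a \<longrightarrow> a = m"
  proof (rule predicate_Zorn)
    show "partial_order_on A (relation_of D A)"
      by (rule partial_order_on_relation_ofI)
         (auto simp: D_def fun_eq_iff intro: order_trans antisym)
    fix C assume "C \<in> Chains (relation_of D A)"
    then have CA: "C \<subseteq> A" and chain: "\<And>a b. a \<in> C \<Longrightarrow> b \<in> C \<Longrightarrow> D a b \<or> D b a"
      by (auto simp: Chains_def relation_of_def)
    show "\<exists>u\<in>A. \<forall>a\<in>C. D a u"
    proof (cases "C = {}")
      case True
      then show ?thesis using P by (auto simp: A_def)
    next
      case False
      define R where "R x = (INF Q\<in>C. Q x)" for x
      have sub: "sublinear_functional Q" if "Q \<in> C" for Q
        using that CA by (auto simp: A_def)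
      have low: "- P (- x) \<le> Q x" if "Q \<in> C" for Q x
      proof -
        have "Q (- x) \<le> P (- x)" using that CA by (auto simp: A_def)
        then show ?thesis using sublinear_neg[OF sub[OF that], of x] by linarith
      qed
      have le: "R x \<le> Q x" if "Q \<in> C" for Q x
        unfolding R_def using that low
        by (intro cINF_lower bdd_belowI2[where m = "- P (- x)"]) auto
      have ge: "m \<le> R x" if "\<And>Q. Q \<in> C \<Longrightarrow> m \<le> Q x" for m x
        unfolding R_def using that False by (intro cINF_greatest) auto
      have "sublinear_functional R"
      proof (rule sublinear_functionalI)
        show "R (x + y) \<le> R x + R y" for x y
        proof -
          \<comment> \<open>Of two comparable members the smaller one serves at both
            \<open>x\<close> and \<open>y\<close>; this is where the chain property enters.\<close>
          have key: "R (x + y) \<le> Q x + Q' y" if QQ: "Q \<in> C" "Q' \<in> C" for Q Q'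
          proof -
            obtain S where "S \<in> C" "S x \<le> Q x" "S y \<le> Q' y"
              using chain[OF QQ] QQ unfolding D_def by (metis order_refl)
            then show ?thesis
              using le[of S "x + y"] sublinear_add[OF sub, of S x y] by linarith
          qed
          have "R (x + y) - Q' y \<le> R x" if "Q' \<in> C" for Q'
            using key that by (intro ge) (simp add: algebra_simps)
          then have "R (x + y) - R x \<le> R y"
            by (intro ge) (simp add: algebra_simps)
          then show ?thesis by simp
        qed
        show "R 0 = 0"
        proof (rule antisym)
          obtain Q where "Q \<in> C" using False by blast
          then show "R 0 \<le> 0" using le[of Q 0] sublinear_zero[OF sub[of Q]] by simp
          show "0 \<le> R 0" using sublinear_zero[OF sub] by (intro ge) (metis order_refl)
        qed
        show "R (c *\<^sub>R x) \<le> c * R x" if c: "0 < c" for c x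
        proof -
          have "R (c *\<^sub>R x) / c \<le> R x"
          proof (rule ge)
            fix Q assume "Q \<in> C"
            then show "R (c *\<^sub>R x) / c \<le> Q x"
              using le[of Q "c *\<^sub>R x"] sublinear_scale[OF sub, of Q c x] c
              by (simp add: field_simps)
          qed
          then show ?thesis using c by (simp add: field_simps)
        qed
      qed
      moreover have "R x \<le> P x" for x
      proof -
        obtain Q where "Q \<in> C" using False by blast
        then have "Q x \<le> P x" using CA by (auto simp: A_def)
        with le[OF \<open>Q \<in> C\<close>, of x] show ?thesis by linarith
      qed
      ultimately have "R \<in> A" by (simp add: A_def)
      then show ?thesis using le by (auto simp: D_def)
    qed
  qed
  then obtain m where "m \<in> A" and min: "\<And>a. a \<in> A \<Longrightarrow> D m a \<Longrightarrow> a = m" by blast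
  show ?thesis
  proof (rule that[of m])
    show "sublinear_functional m" "m x \<le> P x" for x
      using \<open>m \<in> A\<close> by (auto simp: A_def)
    fix R assume "sublinear_functional R" "\<And>x. R x \<le> m x"
    then show "R = m"
      using \<open>m \<in> A\<close> by (intro min) (auto simp: A_def D_def intro: order_trans)
  qed
qed

text \<open>A minimal sublinear functional is odd, and oddness turns subadditivity and positive
  homogeneity into linearity. Starting the minimization at \<open>P'\<close> instead of
  \<open>P\<close> gives \<open>Q (- z) \<le> - P z\<close>, hence equality at
  \<open>z\<close>.\<close>

theorem Hahn_Banach_sublinear:
  fixes P :: "'a::real_vector \<Rightarrow> real"
  assumes P: "sublinear_functional P"
  obtains \<phi> where "linear \<phi>" "\<And>x. \<phi> x \<le> P x" "\<phi> z = P z"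
proof -
  obtain P' where P': "sublinear_functional P'" "\<And>x. P' x \<le> P x" "P' (- z) \<le> - P z"
    using sublinear_directional[OF P, of z] by metis
  obtain Q where Q: "sublinear_functional Q" and QP: "\<And>x. Q x \<le> P' x"
    and min: "\<And>R. sublinear_functional R \<Longrightarrow> (\<And>x. R x \<le> Q x) \<Longrightarrow> R = Q"
    using minimal_sublinear_exists[OF P'(1)] by metis
  have odd: "Q (- x) = - Q x" for x
  proof -
    obtain R where R: "sublinear_functional R" "\<And>y. R y \<le> Q y" "R (- x) \<le> - Q x"
      using sublinear_directional[OF Q, of x] by metis
    then have "Q (- x) \<le> - Q x" using min[OF R(1,2)] by simp
    then show ?thesis using sublinear_neg[OF Q, of x] by linarith
  qed
  have add: "Q (x + y) = Q x + Q y" for x y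
    using sublinear_add[OF Q, of x y] sublinear_add[OF Q, of "- x" "- y"] odd[of x] odd[of y]
      odd[of "x + y"] by simp
  have scale: "Q (c *\<^sub>R x) = c * Q x" for c x
  proof (cases "c \<ge> 0")
    case True
    then show ?thesis by (rule sublinear_scale[OF Q])
  next
    case False
    then show ?thesis
      using sublinear_scale[OF Q, of "- c" x] odd[of "c *\<^sub>R x"] by simp
  qed
  show ?thesis
  proof (rule that[of Q])
    show "linear Q" using add scale by (intro linearI) auto
    show "Q x \<le> P x" for x using QP P'(2) order_trans by blast
    then show "Q z = P z"
      using QP[of "- z"] P'(3) odd[of z] by (smt (verit))
  qed
qed

lemma Hahn_Banach_bounded:
  fixes P :: "'a::real_normed_vector \<Rightarrow> real"
  assumes P: "sublinear_functional P" and B: "\<And>x. P x \<le> B * norm x"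
  obtains \<phi> :: "'a \<Rightarrow>\<^sub>L real" where "\<And>x. blinfun_apply \<phi> x \<le> P x" "blinfun_apply \<phi> z = P z"
proof -
  obtain \<phi> where lin: "linear \<phi>" and le: "\<And>x. \<phi> x \<le> P x" and z: "\<phi> z = P z"
    using Hahn_Banach_sublinear[OF P] by metis
  have "bounded_linear \<phi>"
  proof (rule bounded_linear_intro)
    fix x y r
    show "\<phi> (x + y) = \<phi> x + \<phi> y" "\<phi> (r *\<^sub>R x) = r *\<^sub>R \<phi> x"
      using lin by (simp_all add: linear_add linear_scale)
    have "\<phi> (- x) = - \<phi> x" using lin by (rule linear_neg)
    then show "norm (\<phi> x) \<le> norm x * B"
      using le[of x] le[of "- x"] B[of x] B[of "- x"] by (simp add: abs_le_iff mult.commute)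
  qed
  then show ?thesis
    using that[of "Blinfun \<phi>"] le z by (simp add: bounded_linear_Blinfun_apply)
qed

lemma norming_functional:
  fixes z :: "'a::real_normed_vector"
  obtains \<phi> :: "'a \<Rightarrow>\<^sub>L real" where "norm \<phi> \<le> 1" "blinfun_apply \<phi> z = norm z"
proof -
  have "sublinear_functional (norm :: 'a \<Rightarrow> real)"
    by (rule sublinear_functionalI) (auto intro: norm_triangle_ineq)
  then obtain \<phi> :: "'a \<Rightarrow>\<^sub>L real"
    where le: "\<And>x. blinfun_apply \<phi> x \<le> norm x" and z: "blinfun_apply \<phi> z = norm z"
    by (rule Hahn_Banach_bounded[where B = 1 and z = z]) auto
  have "norm (blinfun_apply \<phi> x) \<le> 1 * norm x" for x
    using le[of x] le[of "- x"] by (simp add: abs_le_iff blinfun.minus_right)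
  then show ?thesis
    using that[of \<phi>] z norm_blinfun_bound[of 1 \<phi>] by simp
qed

text \<open>The distance to the span is a sublinear function that vanishes on the span and is
  positive at \<open>z\<close>; a dominated functional that touches it at \<open>z\<close>
  separates.\<close>

lemma separating_functional_span:
  fixes z :: "'a::real_normed_vector"
  assumes "z \<notin> closure (span S)"
  obtains \<phi> :: "'a \<Rightarrow>\<^sub>L real" where "\<And>x. x \<in> S \<Longrightarrow> blinfun_apply \<phi> x = 0" "blinfun_apply \<phi> z \<noteq> 0"
proof -
  have ne: "span S \<noteq> {}" using span_zero by blast
  define P where "P x = infdist x (span S)" for x
  have le: "P x \<le> norm (x - y)" if "y \<in> span S" for x y
    using infdist_le[OF that, of x] by (simp add: P_def dist_norm)
  have ge: "m \<le> P x" if "\<And>y. y \<in> span S \<Longrightarrow> m \<le> norm (x - y)" for m x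
    unfolding P_def infdist_def using ne that by (auto intro!: cINF_greatest simp: dist_norm)
  have "sublinear_functional P"
  proof (rule sublinear_functionalI)
    show "P (x + y) \<le> P x + P y" for x y
    proof -
      have "P (x + y) - norm (y - b) \<le> P x" if b: "b \<in> span S" for b
      proof (rule ge)
        fix a assume "a \<in> span S"
        then have "P (x + y) \<le> norm ((x + y) - (a + b))"
          using b by (intro le span_add)
        also have "\<dots> \<le> norm (x - a) + norm (y - b)"
          by (rule norm_diff_triangle_ineq)
        finally show "P (x + y) - norm (y - b) \<le> norm (x - a)" by simp
      qed
      then have "P (x + y) - P x \<le> P y"
        by (intro ge) (simp add: algebra_simps)
      then show ?thesis by simp
    qed
    show "P 0 = 0"
      using span_zero infdist_zero by (force simp: P_def)
    show "P (c *\<^sub>R x) \<le> c * P x" if c: "0 < c" for c x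
    proof -
      have "P (c *\<^sub>R x) / c \<le> P x"
      proof (rule ge)
        fix y assume "y \<in> span S"
        then have "P (c *\<^sub>R x) \<le> norm (c *\<^sub>R x - c *\<^sub>R y)"
          by (intro le span_scale)
        also have "\<dots> = c * norm (x - y)"
          using c by (simp flip: scaleR_diff_right)
        finally show "P (c *\<^sub>R x) / c \<le> norm (x - y)"
          using c by (simp add: field_simps)
      qed
      then show ?thesis using c by (simp add: field_simps)
    qed
  qed
  moreover have "P x \<le> 1 * norm x" for x
    using le[OF span_zero, of x] by simp
  ultimately obtain \<phi> :: "'a \<Rightarrow>\<^sub>L real"
    where \<phi>: "\<And>x. blinfun_apply \<phi> x \<le> P x" "blinfun_apply \<phi> z = P z"
    using Hahn_Banach_bounded[of P 1 z] by metis
  show ?thesis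
  proof (rule that[of \<phi>])
    fix x assume "x \<in> S"
    then have "P x = 0" "P (- x) = 0"
      by (simp_all add: P_def span_base span_neg)
    then show "blinfun_apply \<phi> x = 0"
      using \<phi>(1)[of x] \<phi>(1)[of "- x"] by (simp add: blinfun.minus_right)
  next
    show "blinfun_apply \<phi> z \<noteq> 0"
      using assms ne in_closure_iff_infdist_zero[of "span S" z] \<phi>(2) by (simp add: P_def)
  qed
qed

section \<open>Weak convergence and reflexivity\<close>

text \<open>Uniform boundedness: the Baire category theorem in the dual, which is complete, yields a
  ball of functionals on which the values at all \<open>u n\<close> share one bound. Norming
  functionals carry the bound back to the norms.\<close>

lemma weakly_bounded_imp_bounded:
  fixes u :: "nat \<Rightarrow> 'a::real_normed_vector"
  assumes bdd: "\<And>\<xi> :: 'a \<Rightarrow>\<^sub>L real. bounded (range (\<lambda>n. blinfun_apply \<xi> (u n)))"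
  obtains B where "B > 0" "\<And>n. norm (u n) \<le> B"
proof -
  define F where "F k = {\<xi> :: 'a \<Rightarrow>\<^sub>L real. \<forall>n. \<bar>blinfun_apply \<xi> (u n)\<bar> \<le> real k}" for k :: nat
  have closed: "closed (F k)" for k
    unfolding F_def
    by (intro closed_Collect_all closed_Collect_le continuous_intros)
  have cover: "(\<Union>k. F k) = UNIV"
  proof (intro set_eqI iffI UNIV_I)
    fix \<xi> :: "'a \<Rightarrow>\<^sub>L real"
    obtain b where b: "\<And>n. \<bar>blinfun_apply \<xi> (u n)\<bar> \<le> b"
      using bdd[of \<xi>] by (auto simp: bounded_iff)
    obtain k :: nat where "b \<le> real k" using real_arch_simple by blast
    then have "\<xi> \<in> F k" using b order_trans unfolding F_def by blast
    then show "\<xi> \<in> (\<Union>k. F k)" by blast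
  qed
  have "\<exists>k. interior (F k) \<noteq> {}"
  proof (rule ccontr)
    assume "\<nexists>k. interior (F k) \<noteq> {}"
    then have "Met_TC.mtopology interior_of (\<Union>(range F)) = {}"
      using closed
      by (intro Met_TC.metric_Baire_category_alt)
         (auto simp: complete_UNIV)
    then show False using cover by simp
  qed
  then obtain k \<xi>0 where "\<xi>0 \<in> interior (F k)" by blast
  then obtain e where e: "e > 0" "cball \<xi>0 e \<subseteq> F k"
    by (meson mem_interior_cball)
  \<comment> \<open>Both the centre \<open>\<xi>0\<close> and
    \<open>\<xi>0 + e *\<^sub>R \<xi>\<close> lie in \<open>F k\<close>; their difference accounts
    for the factor 2.\<close>
  have bound: "\<bar>blinfun_apply \<xi> (u n)\<bar> \<le> 2 * real k / e" if "norm \<xi> \<le> 1" for \<xi> n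
  proof -
    have "\<xi>0 + e *\<^sub>R \<xi> \<in> cball \<xi>0 e" "\<xi>0 \<in> cball \<xi>0 e"
      using e(1) that by (auto simp: dist_norm mult_left_le)
    then have "\<xi>0 + e *\<^sub>R \<xi> \<in> F k" "\<xi>0 \<in> F k" using e(2) by blast+
    then have "\<bar>blinfun_apply \<xi>0 (u n) + e * blinfun_apply \<xi> (u n)\<bar> \<le> real k"
      "\<bar>blinfun_apply \<xi>0 (u n)\<bar> \<le> real k"
      by (auto simp: F_def blinfun.add_left blinfun.scaleR_left)
    then have "\<bar>e * blinfun_apply \<xi> (u n)\<bar> \<le> 2 * real k" by linarith
    then show ?thesis using e(1) by (simp add: abs_mult field_simps)
  qed
  show ?thesis
  proof (rule that[of "2 * real k / e + 1"])
    show "2 * real k / e + 1 > 0" using e(1) by (simp add: add_nonneg_pos)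
    fix n
    obtain \<phi> :: "'a \<Rightarrow>\<^sub>L real" where "norm \<phi> \<le> 1" "blinfun_apply \<phi> (u n) = norm (u n)"
      using norming_functional[of "u n"] by metis
    then show "norm (u n) \<le> 2 * real k / e + 1" using bound[of \<phi> n] by simp
  qed
qed

lemma weakly_convergent_bounded:
  assumes "weakly_converges_to u x"
  obtains B where "B > 0" "\<And>n. norm (u n) \<le> B"
proof -
  have "bounded (range (\<lambda>n. blinfun_apply \<xi> (u n)))" for \<xi> :: "'a \<Rightarrow>\<^sub>L real"
    using assms by (auto simp: weakly_converges_to_def intro: convergent_imp_bounded)
  then show ?thesis using weakly_bounded_imp_bounded[of u] that by blast
qed

lemma weakly_converges_subseq:
  fixes u :: "nat \<Rightarrow> 'a::real_normed_vector"
  assumes "weakly_converges_to u x" "strict_mono r"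
  shows "weakly_converges_to (\<lambda>n. u (r n)) x"
  unfolding weakly_converges_to_def
proof
  fix \<xi> :: "'a \<Rightarrow>\<^sub>L real"
  have "(\<lambda>n. blinfun_apply \<xi> (u n)) \<longlonglongrightarrow> blinfun_apply \<xi> x"
    using assms(1) unfolding weakly_converges_to_def by blast
  from LIMSEQ_subseq_LIMSEQ[OF this assms(2)]
  show "(\<lambda>n. blinfun_apply \<xi> (u (r n))) \<longlonglongrightarrow> blinfun_apply \<xi> x"
    by (simp add: o_def)
qed

lemma weakly_converges_diff:
  "weakly_converges_to u x \<Longrightarrow> weakly_converges_to v y \<Longrightarrow>
    weakly_converges_to (\<lambda>n. u n - v n) (x - y)"
  unfolding weakly_converges_to_def blinfun.diff_right by (intro allI tendsto_diff) auto

lemma tendsto_imp_weakly_converges: "u \<longlonglongrightarrow> x \<Longrightarrow> weakly_converges_to u x"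
  unfolding weakly_converges_to_def by (intro allI blinfun.tendsto tendsto_const)

text \<open>Weak lower semicontinuity of the norm, obtained by testing with a norming functional of
  the limit.\<close>

lemma norm_weak_limit_le:
  assumes weak: "weakly_converges_to u x" and lim: "(\<lambda>n. norm (u n)) \<longlonglongrightarrow> s"
  shows "norm x \<le> s"
proof -
  obtain \<phi> where \<phi>: "norm \<phi> \<le> 1" "blinfun_apply \<phi> x = norm x"
    using norming_functional[of x] by metis
  have "blinfun_apply \<phi> (u n) \<le> norm (u n)" for n
  proof -
    have "blinfun_apply \<phi> (u n) \<le> norm \<phi> * norm (u n)"
      using norm_blinfun[of \<phi> "u n"] by simp
    also have "\<dots> \<le> norm (u n)" using \<phi>(1) by (simp add: mult_left_le_one_le)
    finally show ?thesis .
  qed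
  moreover have "(\<lambda>n. blinfun_apply \<phi> (u n)) \<longlonglongrightarrow> norm x"
    using weak \<phi>(2) unfolding weakly_converges_to_def by metis
  ultimately show ?thesis using lim by (meson LIMSEQ_le)
qed

text \<open>
  A generalised limit: the functional \<open>\<xi> \<mapsto> limsup \<xi> (x n)\<close> is sublinear on the dual, and any linear
  functional below it is bounded, hence an evaluation by reflexivity.
\<close>

lemma reflexive_limsup_attained:
  fixes x :: "nat \<Rightarrow> 'a::real_normed_vector"
  assumes refl: "reflexive_space TYPE('a)" and B: "\<And>n. norm (x n) \<le> B"
  obtains y where "\<And>\<xi> :: 'a \<Rightarrow>\<^sub>L real. ereal (blinfun_apply \<xi> y) \<le> limsup (\<lambda>n. ereal (blinfun_apply \<xi> (x n)))"
    "ereal (blinfun_apply \<zeta> y) = limsup (\<lambda>n. ereal (blinfun_apply \<zeta> (x n)))"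
proof -
  define L where "L \<xi> = limsup (\<lambda>n. ereal (blinfun_apply \<xi> (x n)))" for \<xi> :: "'a \<Rightarrow>\<^sub>L real"
  have bound: "\<bar>blinfun_apply \<xi> (x n)\<bar> \<le> B * norm \<xi>" for \<xi> n
  proof -
    have "\<bar>blinfun_apply \<xi> (x n)\<bar> \<le> norm \<xi> * norm (x n)"
      using norm_blinfun[of \<xi> "x n"] by simp
    also have "\<dots> \<le> norm \<xi> * B" using B by (intro mult_left_mono) auto
    finally show ?thesis by (simp add: mult.commute)
  qed
  have up: "L \<xi> \<le> ereal (B * norm \<xi>)" for \<xi>
    unfolding L_def using bound by (intro Limsup_bounded always_eventually) (auto simp: abs_le_iff)
  have low: "ereal (- (B * norm \<xi>)) \<le> L \<xi>" for \<xi>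
    unfolding L_def using bound by (intro le_Limsup always_eventually) (auto simp: abs_le_iff minus_le_iff)
  define P where "P \<xi> = real_of_ereal (L \<xi>)" for \<xi>
  have LP: "L \<xi> = ereal (P \<xi>)" for \<xi>
    using up[of \<xi>] low[of \<xi>] by (cases "L \<xi>") (auto simp: P_def)
  have "sublinear_functional P"
  proof (rule sublinear_functionalI)
    fix \<xi> \<eta> :: "'a \<Rightarrow>\<^sub>L real"
    have "L (\<xi> + \<eta>) \<le> L \<xi> + L \<eta>"
      using ereal_limsup_add_mono[of "\<lambda>n. ereal (blinfun_apply \<xi> (x n))"
          "\<lambda>n. ereal (blinfun_apply \<eta> (x n))"]
      by (simp add: L_def blinfun.add_left)
    then show "P (\<xi> + \<eta>) \<le> P \<xi> + P \<eta>" by (simp add: LP)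
  next
    have "L 0 = 0" by (simp add: L_def Limsup_const zero_ereal_def)
    then show "P 0 = 0" by (simp add: LP)
  next
    fix c and \<xi> :: "'a \<Rightarrow>\<^sub>L real" assume "(0 :: real) < c"
    then have "L (c *\<^sub>R \<xi>) = ereal c * L \<xi>"
      using limsup_ereal_mult_left[of c "\<lambda>n. ereal (blinfun_apply \<xi> (x n))"]
      by (simp add: L_def blinfun.scaleR_left)
    then show "P (c *\<^sub>R \<xi>) \<le> c * P \<xi>" by (simp add: LP)
  qed
  moreover have "P \<xi> \<le> B * norm \<xi>" for \<xi>
    using up[of \<xi>] by (simp add: LP)
  ultimately obtain \<Phi> :: "('a \<Rightarrow>\<^sub>L real) \<Rightarrow>\<^sub>L real"
    where \<Phi>: "\<And>\<xi>. blinfun_apply \<Phi> \<xi> \<le> P \<xi>" "blinfun_apply \<Phi> \<zeta> = P \<zeta>"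
    using Hahn_Banach_bounded[of P B \<zeta>] by metis
  obtain y where "\<And>\<xi>. blinfun_apply \<Phi> \<xi> = blinfun_apply \<xi> y"
    using refl unfolding reflexive_space_def by blast
  then show ?thesis
    using that[of y] \<Phi> LP by (simp add: L_def)
qed

text \<open>Finite rational combinations, indexed by lists, form a countable set. Induction over the
  span approximates one real coefficient at a time by rationals.\<close>

lemma countable_dense_in_span:
  fixes x :: "nat \<Rightarrow> 'a::real_normed_vector"
  obtains E where "countable E" "closure (span (range x)) \<subseteq> closure E"
proof -
  define E where "E = range (\<lambda>l :: (rat \<times> nat) list. \<Sum>(r, i)\<leftarrow>l. of_rat r *\<^sub>R x i)"
  have E0: "0 \<in> E" unfolding E_def by (rule range_eqI[of _ _ "[]"]) simp
  have step: "of_rat r *\<^sub>R x i + e \<in> E" if e: "e \<in> E" for r i e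
  proof -
    obtain l where "e = (\<Sum>(r, i)\<leftarrow>l. of_rat r *\<^sub>R x i)" using e unfolding E_def by blast
    then show ?thesis unfolding E_def by (intro range_eqI[of _ _ "(r, i) # l"]) simp
  qed
  have "y \<in> closure E" if "y \<in> span (range x)" for y
    using that
  proof (induction rule: span_induct_alt)
    case base
    then show ?case using E0 closure_subset by blast
  next
    case (step c z y)
    then obtain i where z: "z = x i" by blast
    obtain e where e: "\<And>n. e n \<in> E" "e \<longlonglongrightarrow> y"
      using step.IH by (auto simp: closure_sequential)
    have "\<exists>r. \<bar>of_rat r - c\<bar> < inverse (real (Suc n))" for n
    proof -
      have "c < c + inverse (real (Suc n))" by simp
      then obtain r where "c < of_rat r" "of_rat r < c + inverse (real (Suc n))"
        using of_rat_dense by blast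
      then show ?thesis by (intro exI[of _ r]) simp
    qed
    then obtain r where r: "\<And>n. \<bar>of_rat (r n) - c\<bar> < inverse (real (Suc n))" by metis
    have "(\<lambda>n. of_rat (r n) - c) \<longlonglongrightarrow> 0"
      by (rule Lim_null_comparison[OF _ LIMSEQ_inverse_real_of_nat])
         (use r in \<open>auto intro!: always_eventually less_imp_le\<close>)
    then have "(\<lambda>n. of_rat (r n)) \<longlonglongrightarrow> c" by (simp add: LIM_zero_iff)
    then have "(\<lambda>n. of_rat (r n) *\<^sub>R x i + e n) \<longlonglongrightarrow> c *\<^sub>R x i + y"
      using e(2) by (intro tendsto_intros)
    moreover have "of_rat (r n) *\<^sub>R x i + e n \<in> E" for n
      using \<open>\<And>r i e. e \<in> E \<Longrightarrow> of_rat r *\<^sub>R x i + e \<in> E\<close> e(1) by blast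
    ultimately show ?case
      unfolding closure_sequential z
      by (intro exI[of _ "\<lambda>n. of_rat (r n) *\<^sub>R x i + e n"]) simp
  qed
  then have "closure (span (range x)) \<subseteq> closure E"
    by (intro closure_minimal) auto
  moreover have "countable E" unfolding E_def by simp
  ultimately show ?thesis using that by blast
qed

text \<open>
  Whitley's argument: along a diagonal subsequence countably many functionals that separate the
  points of the closed span converge; by the generalised limits above, so does every functional.
\<close>

theorem reflexive_weakly_sequentially_compact:
  fixes x :: "nat \<Rightarrow> 'a::real_normed_vector"
  assumes refl: "reflexive_space TYPE('a)" and B: "\<And>n. norm (x n) \<le> B"
  obtains r y where "strict_mono r" "weakly_converges_to (\<lambda>n. x (r n)) y"
proof -
  obtain E where "countable E" and dense: "closure (span (range x)) \<subseteq> closure E"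
    using countable_dense_in_span[of x] by metis
  then have "E \<noteq> {}" using span_zero[of "range x"] closure_subset by fastforce
  then obtain e :: "nat \<Rightarrow> 'a" where e: "range e = E"
    using \<open>countable E\<close> uncountable_def by blast
  have "\<forall>k. \<exists>\<phi> :: 'a \<Rightarrow>\<^sub>L real. norm \<phi> \<le> 1 \<and> blinfun_apply \<phi> (e k) = norm (e k)"
    using norming_functional by metis
  then obtain D :: "nat \<Rightarrow> 'a \<Rightarrow>\<^sub>L real"
    where D: "\<And>k. norm (D k) \<le> 1" "\<And>k. blinfun_apply (D k) (e k) = norm (e k)"
    by metis
  \<comment> \<open>If every \<open>D k\<close> kills \<open>z\<close>, then
    \<open>norm (e k) \<le> norm (e k - z)\<close>. For \<open>e k\<close> closer to
    \<open>z\<close> than \<open>norm z / 2\<close> this contradicts the triangle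
    inequality.\<close>
  have separating: "z = 0"
    if "z \<in> closure (span (range x))" "\<And>k. blinfun_apply (D k) z = 0" for z
  proof (rule ccontr)
    assume "z \<noteq> 0"
    then have "norm z / 2 > 0" by simp
    moreover have "z \<in> closure E" using that(1) dense by blast
    ultimately obtain k where k: "dist (e k) z < norm z / 2"
      unfolding closure_approachable using e by blast
    have "norm (e k) = blinfun_apply (D k) (e k - z)"
      by (simp add: blinfun.diff_right D(2) that(2))
    also have "\<dots> \<le> norm (D k) * norm (e k - z)"
      using norm_blinfun[of "D k" "e k - z"] by simp
    also have "\<dots> \<le> norm (e k - z)" using D(1) by (simp add: mult_left_le_one_le)
    finally show False
      using k norm_triangle_ineq4[of "e k" "e k - z"] by (simp add: dist_norm)
  qed
  interpret subseqs "\<lambda>k s. convergent (\<lambda>n. blinfun_apply (D k) (x (s n)))"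
  proof
    fix k and s :: "nat \<Rightarrow> nat"
    have "norm (blinfun_apply (D k) (x (s n))) \<le> norm (D k) * B" for n
      using norm_blinfun[of "D k" "x (s n)"] B[of "s n"]
      by (meson mult_left_mono norm_ge_zero order_trans)
    then have "bounded (range (\<lambda>n. blinfun_apply (D k) (x (s n))))"
      by (auto simp: bounded_iff)
    from bounded_imp_convergent_subsequence[OF this]
    show "\<exists>r'. strict_mono r' \<and> convergent (\<lambda>n. blinfun_apply (D k) (x ((s \<circ> r') n)))"
      by (auto simp: convergent_def o_def)
  qed
  define y where "y n = x (diagseq n)" for n
  have Dconv: "convergent (\<lambda>n. blinfun_apply (D k) (y n))" for k
  proof -
    \<comment> \<open>Only the tail of the diagonal sequence after index \<open>k\<close> is known
      to refine the \<open>k\<close>-th subsequence, hence the shift, which is removed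
      afterwards.\<close>
    have "convergent (\<lambda>n. blinfun_apply (D k) (x ((diagseq \<circ> (+) (Suc k)) n)))"
    proof (rule diagseq_holds)
      fix r s :: "nat \<Rightarrow> nat" and n
      assume "strict_mono r" "convergent (\<lambda>i. blinfun_apply (D n) (x (s i)))"
      then show "convergent (\<lambda>i. blinfun_apply (D n) (x ((s \<circ> r) i)))"
        using convergent_subseq_convergent[of "\<lambda>i. blinfun_apply (D n) (x (s i))" r]
        by (simp add: o_def)
    qed
    then have "convergent (\<lambda>n. blinfun_apply (D k) (y (n + Suc k)))"
      by (simp add: y_def add.commute)
    then obtain l where "(\<lambda>n. blinfun_apply (D k) (y (n + Suc k))) \<longlonglongrightarrow> l"
      unfolding convergent_def ..
    then show ?thesis by (rule convergentI[OF LIMSEQ_offset])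
  qed
  have yB: "norm (y n) \<le> B" for n by (simp add: y_def B)
  \<comment> \<open>The points satisfying \<open>below\<close> are the generalised limits of
    \<open>y\<close>: whenever \<xi> converges along \<open>y\<close>, testing with \<xi> and its
    negative forces the value at \<open>v\<close> to be that limit.\<close>
  define below where "below v \<longleftrightarrow>
    (\<forall>\<xi> :: 'a \<Rightarrow>\<^sub>L real. ereal (blinfun_apply \<xi> v) \<le> limsup (\<lambda>n. ereal (blinfun_apply \<xi> (y n))))" for v
  have at_limit: "blinfun_apply \<xi> v = l"
    if "below v" "(\<lambda>n. blinfun_apply \<xi> (y n)) \<longlonglongrightarrow> l" for v l and \<xi> :: "'a \<Rightarrow>\<^sub>L real"
  proof -
    have le: "blinfun_apply \<eta> v \<le> m" if "(\<lambda>n. blinfun_apply \<eta> (y n)) \<longlonglongrightarrow> m" for m and \<eta> :: "'a \<Rightarrow>\<^sub>L real"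
    proof -
      have "limsup (\<lambda>n. ereal (blinfun_apply \<eta> (y n))) = ereal m"
        using that by (intro lim_imp_Limsup) auto
      then show ?thesis using \<open>below v\<close> unfolding below_def by (metis ereal_less_eq(3))
    qed
    have "(\<lambda>n. blinfun_apply (- \<xi>) (y n)) \<longlonglongrightarrow> - l"
      using tendsto_minus[OF that(2)] by (simp add: blinfun.minus_left)
    from le[OF that(2)] le[OF this] show ?thesis by (simp add: blinfun.minus_left)
  qed
  \<comment> \<open>A functional that vanishes on all \<open>x n\<close> has limit 0 along
    \<open>y\<close>, so it vanishes at \<open>v\<close> too and cannot separate \<open>v\<close>
    from the span.\<close>
  have in_span: "v \<in> closure (span (range x))" if "below v" for v
  proof (rule ccontr)
    assume "v \<notin> closure (span (range x))"
    then obtain \<phi> :: "'a \<Rightarrow>\<^sub>L real"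
      where \<phi>: "\<And>z. z \<in> range x \<Longrightarrow> blinfun_apply \<phi> z = 0" "blinfun_apply \<phi> v \<noteq> 0"
      using separating_functional_span by metis
    then have "(\<lambda>n. blinfun_apply \<phi> (y n)) \<longlonglongrightarrow> 0" by (simp add: y_def)
    then show False using at_limit[OF that] \<phi>(2) by blast
  qed
  have unique: "v = w" if vw: "below v" "below w" for v w
  proof -
    obtain a b where ab: "\<And>n. a n \<in> span (range x)" "a \<longlonglongrightarrow> v"
      "\<And>n. b n \<in> span (range x)" "b \<longlonglongrightarrow> w"
      using in_span[OF vw(1)] in_span[OF vw(2)] unfolding closure_sequential by blast
    then have "\<forall>n. a n - b n \<in> span (range x)" "(\<lambda>n. a n - b n) \<longlonglongrightarrow> v - w"
      by (auto intro: span_diff tendsto_diff)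
    then have "v - w \<in> closure (span (range x))"
      unfolding closure_sequential by (intro exI[of _ "\<lambda>n. a n - b n"]) simp
    moreover have "blinfun_apply (D k) (v - w) = 0" for k
    proof -
      obtain l where l: "(\<lambda>n. blinfun_apply (D k) (y n)) \<longlonglongrightarrow> l"
        using Dconv[of k] unfolding convergent_def ..
      show ?thesis
        by (simp add: at_limit[OF vw(1) l] at_limit[OF vw(2) l] blinfun.diff_right)
    qed
    ultimately show ?thesis using separating[of "v - w"] by simp
  qed
  have attained: "\<exists>v. below v \<and> ereal (blinfun_apply \<xi> v) = limsup (\<lambda>n. ereal (blinfun_apply \<xi> (y n)))"
    for \<xi> :: "'a \<Rightarrow>\<^sub>L real"
    unfolding below_def by (rule reflexive_limsup_attained[where x = y and B = B and \<zeta> = \<xi>, OF refl yB]) blast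
  then obtain v where v: "below v" by blast
  \<comment> \<open>The limsup of each functional is attained at some generalised limit, and there
    is only one, so the single point \<open>v\<close> serves all functionals. Using the negative
    functional then identifies the liminf.\<close>
  have sup: "limsup (\<lambda>n. ereal (blinfun_apply \<xi> (y n))) = ereal (blinfun_apply \<xi> v)"
    for \<xi> :: "'a \<Rightarrow>\<^sub>L real"
    using attained[of \<xi>] unique[OF v] by force
  have "weakly_converges_to y v"
    unfolding weakly_converges_to_def
  proof
    fix \<xi> :: "'a \<Rightarrow>\<^sub>L real"
    have "ereal (blinfun_apply \<xi> v) \<le> liminf (\<lambda>n. ereal (blinfun_apply \<xi> (y n)))"
      using sup[of "- \<xi>"] ereal_Limsup_uminus[of sequentially "\<lambda>n. ereal (blinfun_apply \<xi> (y n))"]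
      by (simp add: blinfun.minus_left ereal_uminus_eq_reorder flip: uminus_ereal.simps(1))
    then show "(\<lambda>n. blinfun_apply \<xi> (y n)) \<longlonglongrightarrow> blinfun_apply \<xi> v"
      using sup[of \<xi>] by (intro limsup_le_liminf_real) auto
  qed
  then show ?thesis
    using that[of diagseq v] subseq_diagseq unfolding y_def by blast
qed

section \<open>The Moreau--Yosida regularization and its conjugate\<close>

definition penalty :: "real \<Rightarrow> real \<Rightarrow> 'a::real_normed_vector \<Rightarrow> real" where
  "penalty p \<epsilon> x = \<epsilon> / p * norm (x /\<^sub>R \<epsilon>) powr p"

lemma moreau_yosida_penalty:
  "moreau_yosida p \<epsilon> g u = (INF v. ereal (penalty p \<epsilon> (u - v)) + g v)"
  by (simp add: moreau_yosida_def penalty_def)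

lemma moreau_yosida_le: "moreau_yosida p \<epsilon> g u \<le> ereal (penalty p \<epsilon> (u - v)) + g v"
  unfolding moreau_yosida_penalty by (rule INF_lower) simp

lemma penalty_zero [simp]: "penalty p \<epsilon> 0 = 0"
  by (simp add: penalty_def)

lemma penalty_nonneg: "0 < \<epsilon> \<Longrightarrow> 0 < p \<Longrightarrow> 0 \<le> penalty p \<epsilon> x"
  by (simp add: penalty_def)

text \<open>With \<epsilon> separated from the norm, the penalty is visibly a continuous increasing
  function of the norm alone.\<close>

lemma penalty_eq:
  assumes "0 < \<epsilon>"
  shows "penalty p \<epsilon> x = \<epsilon> powr (1 - p) / p * norm x powr p"
  using assms by (simp add: penalty_def powr_mult powr_diff inverse_eq_divide powr_divide)

lemma penalty_mono:
  "0 < \<epsilon> \<Longrightarrow> 1 < p \<Longrightarrow> norm x \<le> s \<Longrightarrow> penalty p \<epsilon> x \<le> \<epsilon> powr (1 - p) / p * s powr p"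
  unfolding penalty_eq by (intro mult_left_mono powr_mono2) auto

lemma tendsto_penalty:
  assumes "0 < \<epsilon>" "1 < p" and lim: "((\<lambda>k. norm (x k)) \<longlongrightarrow> s) F"
  shows "((\<lambda>k. penalty p \<epsilon> (x k)) \<longlongrightarrow> \<epsilon> powr (1 - p) / p * s powr p) F"
  unfolding penalty_eq[OF assms(1)]
  using assms by (intro tendsto_mult tendsto_const tendsto_powr'[OF lim]) auto

text \<open>Young's inequality for \<open>norm (x /\<^sub>R \<epsilon>)\<close> and
  \<open>M\<close>, multiplied by \<epsilon>. The slope \<open>M\<close> is free, so the penalty can
  outgrow any prescribed linear function.\<close>

lemma penalty_ge_linear:
  assumes "0 < \<epsilon>" and pq: "1 < p" "1 < q" "1 / p + 1 / q = 1" and "0 \<le> M"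
  shows "M * norm x - \<epsilon> / q * M powr q \<le> penalty p \<epsilon> x"
proof -
  have "norm (x /\<^sub>R \<epsilon>) * M \<le> norm (x /\<^sub>R \<epsilon>) powr p / p + M powr q / q"
    using assms by (intro Youngs_inequality) auto
  then have "\<epsilon> * (norm (x /\<^sub>R \<epsilon>) * M) \<le> \<epsilon> * (norm (x /\<^sub>R \<epsilon>) powr p / p + M powr q / q)"
    using assms(1) by (intro mult_left_mono) auto
  moreover have "\<epsilon> * (norm (x /\<^sub>R \<epsilon>) * M) = M * norm x"
    using assms(1) by simp
  ultimately have "M * norm x \<le> \<epsilon> * (norm (x /\<^sub>R \<epsilon>) powr p / p + M powr q / q)"
    by (simp only:)
  then show ?thesis by (simp add: penalty_def algebra_simps del: norm_scaleR)
qed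

lemma penalty_ge_linear_uniform:
  assumes "0 < \<epsilon>" "\<epsilon> \<le> 1" and pq: "1 < p" "1 < q" "1 / p + 1 / q = 1" and "0 \<le> M"
  shows "M * norm x - M powr q / q \<le> penalty p \<epsilon> x"
proof -
  have "\<epsilon> / q * M powr q \<le> 1 / q * M powr q"
    using assms by (intro mult_right_mono divide_right_mono) auto
  then show ?thesis using penalty_ge_linear[of \<epsilon> p q M x] assms by simp
qed

text \<open>This computes the conjugate of the penalty through its upper bounds, so no supremum has
  to be attained. Young's inequality gives one direction; for the other, vectors of the optimal
  length are tested in all directions and the operator norm is recovered from the resulting
  bound.\<close>

lemma penalty_conjugate_iff:
  fixes \<xi> :: "'a::real_normed_vector \<Rightarrow>\<^sub>L real"
  assumes \<epsilon>: "0 < \<epsilon>" and pq: "1 < p" "1 < q" "1 / p + 1 / q = 1"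
  shows "(\<forall>x. blinfun_apply \<xi> x - penalty p \<epsilon> x \<le> S) \<longleftrightarrow> \<epsilon> / q * norm \<xi> powr q \<le> S"
proof
  assume le: "\<forall>x. blinfun_apply \<xi> x - penalty p \<epsilon> x \<le> S"
  show "\<epsilon> / q * norm \<xi> powr q \<le> S"
  proof (cases "norm \<xi> = 0")
    case True
    then show ?thesis using le[rule_format, of 0] by simp
  next
    case False
    \<comment> \<open>The equality case of Young's inequality: \<open>s powr p\<close> and
      \<open>s * norm \<xi>\<close> are both \<open>norm \<xi> powr q\<close>.\<close>
    define s where "s = norm \<xi> powr (q - 1)"
    have s: "s > 0" using False by (simp add: s_def)
    have "(q - 1) * p = q"
      using pq by (simp add: field_simps)
    then have sp: "s powr p = norm \<xi> powr q" by (simp add: s_def powr_powr)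
    have sn: "s * norm \<xi> = norm \<xi> powr q"
      using False by (simp add: s_def powr_diff)
    have unit: "\<epsilon> * s * blinfun_apply \<xi> x \<le> S + \<epsilon> / p * s powr p" if "norm x = 1" for x
    proof -
      have "((\<epsilon> * s) *\<^sub>R x) /\<^sub>R \<epsilon> = s *\<^sub>R x" using \<epsilon> by simp
      then have "penalty p \<epsilon> ((\<epsilon> * s) *\<^sub>R x) = \<epsilon> / p * s powr p"
        using that s by (simp only: penalty_def norm_scaleR) simp
      then show ?thesis
        using le[rule_format, of "(\<epsilon> * s) *\<^sub>R x"] by (simp add: blinfun.scaleR_right)
    qed
    define b where "b = (S + \<epsilon> / p * s powr p) / (\<epsilon> * s)"
    have "S \<ge> 0" using le[rule_format, of 0] by simp
    then have "b \<ge> 0" using \<epsilon> s pq by (simp add: b_def)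
    have "norm \<xi> \<le> b"
    proof (rule norm_blinfun_bound[OF \<open>b \<ge> 0\<close>])
      fix x
      have half: "blinfun_apply \<xi> y \<le> b * norm y" for y
      proof (cases "y = 0")
        case False
        then have "\<epsilon> * s * blinfun_apply \<xi> (y /\<^sub>R norm y) \<le> S + \<epsilon> / p * s powr p"
          by (intro unit) simp
        then have "blinfun_apply \<xi> (y /\<^sub>R norm y) \<le> b"
          using \<epsilon> s by (simp add: b_def pos_le_divide_eq mult.commute)
        then show ?thesis
          using False by (simp add: blinfun.scaleR_right field_simps)
      qed simp
      show "norm (blinfun_apply \<xi> x) \<le> b * norm x"
        using half[of x] half[of "- x"] by (simp add: blinfun.minus_right abs_le_iff)
    qed
    then have "norm \<xi> * (\<epsilon> * s) \<le> S + \<epsilon> / p * s powr p"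
      using \<epsilon> s by (simp add: b_def pos_le_divide_eq)
    moreover have "norm \<xi> * (\<epsilon> * s) = \<epsilon> * norm \<xi> powr q"
      using sn by (simp add: mult_ac)
    moreover have "\<epsilon> * norm \<xi> powr q = \<epsilon> / p * norm \<xi> powr q + \<epsilon> / q * norm \<xi> powr q"
    proof -
      have "\<epsilon> * norm \<xi> powr q = (1 / p + 1 / q) * (\<epsilon> * norm \<xi> powr q)"
        using pq by simp
      then show ?thesis by (simp add: algebra_simps)
    qed
    ultimately show ?thesis unfolding sp by linarith
  qed
next
  assume S: "\<epsilon> / q * norm \<xi> powr q \<le> S"
  show "\<forall>x. blinfun_apply \<xi> x - penalty p \<epsilon> x \<le> S"
  proof
    fix x
    have "blinfun_apply \<xi> x \<le> norm \<xi> * norm x"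
      using norm_blinfun[of \<xi> x] by simp
    then show "blinfun_apply \<xi> x - penalty p \<epsilon> x \<le> S"
      using penalty_ge_linear[OF \<epsilon> pq, of "norm \<xi>" x] S by simp
  qed
qed

section \<open>Conjugation of the infimal convolution\<close>

lemma le_convex_conjugate: "ereal (blinfun_apply \<xi> v) - g v \<le> convex_conjugate g \<xi>"
  unfolding convex_conjugate_def by (rule SUP_upper) simp

lemma convex_conjugate_not_MInf:
  assumes "proper_functional g"
  shows "convex_conjugate g \<xi> \<noteq> -\<infinity>"
proof -
  obtain v where "g v \<noteq> \<infinity>" "g v \<noteq> -\<infinity>"
    using assms by (auto simp: proper_functional_def)
  then show ?thesis
    using le_convex_conjugate[of \<xi> v g] by (cases "g v") auto
qed

lemma moreau_yosida_not_PInf: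
  assumes "proper_functional g"
  shows "moreau_yosida p \<epsilon> g u \<noteq> \<infinity>"
proof -
  obtain v where "g v \<noteq> \<infinity>"
    using assms by (auto simp: proper_functional_def)
  then show ?thesis
    using moreau_yosida_le[of p \<epsilon> g u v] by auto
qed

theorem convex_conjugate_moreau_yosida:
  fixes g :: "'a::real_normed_vector \<Rightarrow> ereal"
  assumes g: "proper_functional g"
    and \<epsilon>: "0 < \<epsilon>" and pq: "1 < p" "1 < q" "1 / p + 1 / q = 1"
  shows "convex_conjugate (moreau_yosida p \<epsilon> g) \<xi> =
    ereal (\<epsilon> / q * norm \<xi> powr q) + convex_conjugate g \<xi>"
proof (rule antisym)
  let ?a = "\<epsilon> / q * norm \<xi> powr q"
  have pen: "blinfun_apply \<xi> x - penalty p \<epsilon> x \<le> ?a" for x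
    using penalty_conjugate_iff[OF \<epsilon> pq, of \<xi> ?a] by blast
  show "convex_conjugate (moreau_yosida p \<epsilon> g) \<xi> \<le> ereal ?a + convex_conjugate g \<xi>"
  \<comment> \<open>Only a finite conjugate needs work: the value \<infinity> makes the bound
    trivial, and properness excludes the other infinity.\<close>
  proof (cases "convex_conjugate g \<xi>")
    case (real c)
    have "ereal (blinfun_apply \<xi> u - (?a + c)) \<le> moreau_yosida p \<epsilon> g u" for u
      unfolding moreau_yosida_penalty
    proof (rule INF_greatest)
      fix v
      have "ereal (blinfun_apply \<xi> v) - g v \<le> ereal c"
        using le_convex_conjugate[of \<xi> v g] real by simp
      then show "ereal (blinfun_apply \<xi> u - (?a + c)) \<le> ereal (penalty p \<epsilon> (u - v)) + g v"
        using pen[of "u - v"] by (cases "g v") (auto simp: blinfun.diff_right)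
    qed
    then have "ereal (blinfun_apply \<xi> u) - moreau_yosida p \<epsilon> g u \<le> ereal (?a + c)" for u
      by (cases "moreau_yosida p \<epsilon> g u") (auto simp: algebra_simps dest: meta_spec[of _ u])
    then show ?thesis
      using real by (simp add: convex_conjugate_def[of "moreau_yosida p \<epsilon> g"] SUP_least)
  qed (use convex_conjugate_not_MInf[OF g] in auto)
  show "ereal ?a + convex_conjugate g \<xi> \<le> convex_conjugate (moreau_yosida p \<epsilon> g) \<xi>"
  proof (cases "convex_conjugate (moreau_yosida p \<epsilon> g) \<xi>")
    case (real c)
    have "ereal (blinfun_apply \<xi> v) - g v \<le> ereal (c - ?a)" for v
    proof (cases "g v")
      case (real d)
      \<comment> \<open>With \<open>v\<close> fixed, \<open>x\<close> stands for
        \<open>u - v\<close>. The right-hand side does not depend on \<open>x\<close>, so it bounds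
        the conjugate of the penalty.\<close>
      have "blinfun_apply \<xi> x - penalty p \<epsilon> x \<le> c - blinfun_apply \<xi> v + d" for x
      proof -
        have "moreau_yosida p \<epsilon> g (v + x) \<le> ereal (penalty p \<epsilon> x + d)"
          using moreau_yosida_le[of p \<epsilon> g "v + x" v] real by simp
        moreover have "ereal (blinfun_apply \<xi> (v + x)) - moreau_yosida p \<epsilon> g (v + x) \<le> ereal c"
          using le_convex_conjugate[of \<xi> "v + x" "moreau_yosida p \<epsilon> g"]
            \<open>convex_conjugate (moreau_yosida p \<epsilon> g) \<xi> = ereal c\<close> by simp
        ultimately show ?thesis
          by (cases "moreau_yosida p \<epsilon> g (v + x)") (auto simp: blinfun.add_right)
      qed
      then have "?a \<le> c - blinfun_apply \<xi> v + d"
        using penalty_conjugate_iff[OF \<epsilon> pq] by blast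
      then show ?thesis using real by simp
    qed (use g in \<open>auto simp: proper_functional_def\<close>)
    then have "convex_conjugate g \<xi> \<le> ereal (c - ?a)"
      unfolding convex_conjugate_def by (rule SUP_least)
    then show ?thesis
      using real by (cases "convex_conjugate g \<xi>") auto
  next
    case MInf
    have "ereal (blinfun_apply \<xi> 0) - moreau_yosida p \<epsilon> g 0 \<le> -\<infinity>"
      using le_convex_conjugate[of \<xi> 0 "moreau_yosida p \<epsilon> g"] MInf by simp
    then show ?thesis
      using moreau_yosida_not_PInf[OF g, of p \<epsilon> 0] by (cases "moreau_yosida p \<epsilon> g 0") auto
  qed simp
qed

section \<open>Superlinear growth\<close>

lemma superlinear_uptoD:
  fixes g :: "nat \<Rightarrow> 'a::real_normed_vector \<Rightarrow> ereal"
  assumes "superlinear_upto N g"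
  obtains K where "K > 0" "\<And>n v. n \<le> N \<Longrightarrow> K \<le> norm v \<Longrightarrow> ereal (M * norm v) \<le> g n v"
proof -
  obtain b where b: "\<And>v. b \<le> norm v \<Longrightarrow> ereal M < ereal (1 / norm v) * (INF n\<in>{..N}. g n v)"
    using assms unfolding superlinear_upto_def tendsto_PInfty eventually_at_infinity by blast
  show ?thesis
  \<comment> \<open>The maximum with 1 keeps the norm positive, so that the quotient can be
    cleared.\<close>
  proof (rule that[of "max b 1"])
    fix n and v :: 'a assume n: "n \<le> N" and v: "max b 1 \<le> norm v"
    then have pos: "norm v > 0" and lt: "ereal M < ereal (1 / norm v) * (INF n\<in>{..N}. g n v)"
      using b by auto
    have "ereal (M * norm v) \<le> (INF n\<in>{..N}. g n v)"
      using pos lt by (cases "INF n\<in>{..N}. g n v") (auto simp: field_simps)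
    also have "\<dots> \<le> g n v" using n by (intro INF_lower) auto
    finally show "ereal (M * norm v) \<le> g n v" .
  qed simp
qed

lemma superlinear_uptoI:
  fixes g :: "nat \<Rightarrow> 'a::real_normed_vector \<Rightarrow> ereal"
  assumes "\<And>M. M > 0 \<Longrightarrow> \<exists>K. \<forall>n\<le>N. \<forall>v. K \<le> norm v \<longrightarrow> ereal (M * norm v) \<le> g n v"
  shows "superlinear_upto N g"
  unfolding superlinear_upto_def tendsto_PInfty
proof
  fix r :: real
  define M where "M = \<bar>r\<bar> + 1"
  have "M > 0" by (simp add: M_def)
  from assms[OF this] obtain K
    where K: "\<And>n v. n \<le> N \<Longrightarrow> K \<le> norm v \<Longrightarrow> ereal (M * norm v) \<le> g n v" by blast
  show "\<forall>\<^sub>F v in at_infinity. ereal r < ereal (1 / norm v) * (INF n\<in>{..N}. g n v)"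
    unfolding eventually_at_infinity
  proof (intro exI[of _ "max K 1"] allI impI)
    fix v :: 'a assume v: "max K 1 \<le> norm v"
    then have "ereal (M * norm v) \<le> (INF n\<in>{..N}. g n v)"
      by (intro INF_greatest K) auto
    then have "ereal (1 / norm v) * ereal (M * norm v) \<le> ereal (1 / norm v) * (INF n\<in>{..N}. g n v)"
      by (intro ereal_mult_left_mono) auto
    moreover have "ereal (1 / norm v) * ereal (M * norm v) = ereal M"
      using v by auto
    moreover have "ereal r < ereal M" by (simp add: M_def)
    ultimately show "ereal r < ereal (1 / norm v) * (INF n\<in>{..N}. g n v)"
      by (metis less_le_trans)
  qed
qed

text \<open>Functional and penalty both grow with slope \<open>M + 1\<close> up to constants
  \<open>A\<close> and \<open>D\<close> independent of \<open>\<delta>\<close>. By the triangle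
  inequality so does their sum as a function of \<open>u\<close>, and the spare unit of slope
  absorbs \<open>A + D\<close> once \<open>norm u\<close> exceeds it.\<close>

lemma moreau_yosida_superlinear:
  fixes f :: "nat \<Rightarrow> 'a::real_normed_vector \<Rightarrow> ereal"
  assumes super: "superlinear_upto N f"
    and low: "\<And>n v. ereal (- (C * (1 + norm v))) \<le> f n v" and "C > 0"
    and pq: "1 < p" "1 < q" "1 / p + 1 / q = 1" and "M > 0"
  obtains K where "K > 0"
    "\<And>\<delta> n v. 0 < \<delta> \<Longrightarrow> \<delta> \<le> 1 \<Longrightarrow> n \<le> N \<Longrightarrow> K \<le> norm v \<Longrightarrow>
      ereal (M * norm v) \<le> moreau_yosida p \<delta> (f n) v"
proof -
  obtain K0 where "K0 > 0"
    and K0: "\<And>n v. n \<le> N \<Longrightarrow> K0 \<le> norm v \<Longrightarrow> ereal ((M + 1) * norm v) \<le> f n v"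
    using superlinear_uptoD[OF super, of "M + 1"] by blast
  \<comment> \<open>Chosen to cover the ball of radius \<open>K0\<close>, where only the lower bound
    with constant \<open>C\<close> is available.\<close>
  define A where "A = (M + 1) * K0 + C * (1 + K0)"
  define D where "D = (M + 1) powr q / q"
  have fA: "ereal ((M + 1) * norm v - A) \<le> f n v" if "n \<le> N" for n v
  proof (cases "K0 \<le> norm v")
    case True
    have "0 \<le> A" using \<open>M > 0\<close> \<open>C > 0\<close> \<open>K0 > 0\<close> by (simp add: A_def)
    then have "ereal ((M + 1) * norm v - A) \<le> ereal ((M + 1) * norm v)" by simp
    then show ?thesis using K0[OF that True] order_trans by blast
  next
    case False
    have "(M + 1) * norm v \<le> (M + 1) * K0" "C * (1 + norm v) \<le> C * (1 + K0)"
      using False \<open>M > 0\<close> \<open>C > 0\<close> by (auto intro!: mult_left_mono)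
    then have "ereal ((M + 1) * norm v - A) \<le> ereal (- (C * (1 + norm v)))"
      by (simp add: A_def)
    then show ?thesis using low order_trans by blast
  qed
  show ?thesis
  proof (rule that[of "max 1 (A + D)"])
    fix \<delta> :: real and n and u :: 'a
    assume \<delta>: "0 < \<delta>" "\<delta> \<le> 1" and n: "n \<le> N" and u: "max 1 (A + D) \<le> norm u"
    show "ereal (M * norm u) \<le> moreau_yosida p \<delta> (f n) u"
      unfolding moreau_yosida_penalty
    proof (rule INF_greatest)
      fix v
      have "(M + 1) * norm (u - v) - D \<le> penalty p \<delta> (u - v)"
        unfolding D_def using \<delta> pq \<open>M > 0\<close> by (intro penalty_ge_linear_uniform) auto
      moreover have "(M + 1) * norm u \<le> (M + 1) * norm (u - v) + (M + 1) * norm v"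
        using norm_triangle_ineq[of "u - v" v] \<open>M > 0\<close>
        by (simp flip: distrib_left)
      ultimately have "M * norm u \<le> penalty p \<delta> (u - v) + ((M + 1) * norm v - A)"
        using u by (simp add: algebra_simps)
      then show "ereal (M * norm u) \<le> ereal (penalty p \<delta> (u - v)) + f n v"
        using fA[OF n, of v] by (cases "f n v") auto
    qed
  qed simp
qed

section \<open>Mosco convergence\<close>

text \<open>Filling the indices outside the range of \<open>r\<close> with the limit
  \<open>y\<close> gives a full weakly convergent sequence, whose liminf is at most the liminf along
  \<open>r\<close>.\<close>

lemma mosco_liminf_subseq:
  fixes f :: "nat \<Rightarrow> 'a::real_normed_vector \<Rightarrow> ereal"
  assumes mosco: "mosco_converges f f0" and r: "strict_mono r"
    and v: "weakly_converges_to v y"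
  shows "f0 y \<le> liminf (\<lambda>k. f (r k) (v k))"
proof -
  define w where "w n = (if n \<in> range r then v (inv r n) else y)" for n
  have inj: "inj r" using r by (rule strict_mono_imp_inj_on)
  have wr: "w (r k) = v k" for k by (simp add: w_def inv_f_f[OF inj])
  have "weakly_converges_to w y"
    unfolding weakly_converges_to_def
  proof
    fix \<xi> :: "'a \<Rightarrow>\<^sub>L real"
    have lim: "(\<lambda>k. blinfun_apply \<xi> (v k)) \<longlonglongrightarrow> blinfun_apply \<xi> y"
      using v unfolding weakly_converges_to_def by blast
    show "(\<lambda>n. blinfun_apply \<xi> (w n)) \<longlonglongrightarrow> blinfun_apply \<xi> y"
    proof (rule LIMSEQ_I)
      fix e :: real assume "0 < e"
      then obtain K where K: "\<And>k. k \<ge> K \<Longrightarrow> norm (blinfun_apply \<xi> (v k) - blinfun_apply \<xi> y) < e"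
        using LIMSEQ_D[OF lim] by blast
      have "norm (blinfun_apply \<xi> (w n) - blinfun_apply \<xi> y) < e" if n: "n \<ge> r K" for n
      proof (cases "n \<in> range r")
        case True
        then obtain k where k: "n = r k" by blast
        then have "k \<ge> K" using n strict_mono_less_eq[OF r] by blast
        then show ?thesis using K k wr by simp
      qed (use \<open>0 < e\<close> in \<open>simp add: w_def\<close>)
      then show "\<exists>N. \<forall>n\<ge>N. norm (blinfun_apply \<xi> (w n) - blinfun_apply \<xi> y) < e" by blast
    qed
  qed
  then have "f0 y \<le> liminf (\<lambda>n. f n (w n))"
    using mosco unfolding mosco_converges_def by blast
  also have "\<dots> \<le> liminf ((\<lambda>n. f n (w n)) \<circ> r)"
    by (rule liminf_subseq_mono[OF r])
  finally show ?thesis by (simp add: o_def wr)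
qed

lemma mosco_subseq_limit_le:
  assumes "mosco_converges f f0" "strict_mono r" "weakly_converges_to v y"
    and le: "\<And>k. f (r k) (v k) \<le> a k" and lim: "a \<longlonglongrightarrow> (l :: ereal)"
  shows "f0 y \<le> l"
proof -
  have "f0 y \<le> liminf (\<lambda>k. f (r k) (v k))"
    using assms by (intro mosco_liminf_subseq)
  also have "\<dots> \<le> liminf a"
    using le by (intro Liminf_mono always_eventually) auto
  also have "\<dots> = l" using lim by (intro lim_imp_Liminf) auto
  finally show ?thesis .
qed

section \<open>A linear lower bound uniform along the sequence\<close>

lemma sqrt_shift_at_top: "filterlim (\<lambda>k. sqrt (real (k + 2))) at_top sequentially"
  by (intro filterlim_compose[OF sqrt_at_top] filterlim_compose[OF filterlim_real_sequentially]
      filterlim_add_const_nat_at_top)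

lemma escape_tendsto: "(\<lambda>k. ereal (c - sqrt (real (k + 2)))) \<longlonglongrightarrow> -\<infinity>"
  unfolding tendsto_MInfty
proof
  fix r
  have "eventually (\<lambda>k. c - r < sqrt (real (k + 2))) sequentially"
    using sqrt_shift_at_top unfolding filterlim_at_top_dense by blast
  then show "eventually (\<lambda>k. ereal (c - sqrt (real (k + 2))) < ereal r) sequentially"
    by eventually_elim simp
qed

text \<open>
  Moving from \<open>w k\<close> towards \<open>v k\<close> by a step of length about \<open>1 / sqrt k\<close> keeps the limit, while by
  convexity the very negative value at \<open>v k\<close> drags the functional down.
\<close>

lemma convex_escape:
  fixes g :: "nat \<Rightarrow> 'a::real_normed_vector \<Rightarrow> ereal"
  assumes convex: "\<And>k. convex_functional (g k)"
    and w: "w \<longlonglongrightarrow> x" "\<And>k. g k (w k) \<le> ereal c"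
    and v: "\<And>k. g k (v k) < ereal (- (real (k + 2) * (1 + norm (v k))))"
  obtains z where "z \<longlonglongrightarrow> x" "\<And>k. g k (z k) \<le> ereal (\<bar>c\<bar> - sqrt (real (k + 2)))"
proof -
  define s where "s k = sqrt (real (k + 2))" for k
  \<comment> \<open>The shift by 2 makes this strict, which keeps the convex weight
    \<open>t k\<close> below 1.\<close>
  have s: "s k > 1" for k by (simp add: s_def)
  have ss: "s k * s k = real (k + 2)" for k by (simp add: s_def)
  \<comment> \<open>The step has length of order \<open>1 / s k\<close>, which tends to 0, while the
    contribution of \<open>v k\<close> is \<open>- s k\<close> because the square of
    \<open>s k\<close> is \<open>k + 2\<close>.\<close>
  define t where "t k = 1 / (s k * (1 + norm (v k)))" for k
  have pos: "1 + norm (v k) > 0" for k by (simp add: add_pos_nonneg)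
  have t: "0 < t k" "t k < 1" for k
  proof -
    have "0 \<le> s k * norm (v k)" using s[of k] by (intro mult_nonneg_nonneg) auto
    then have "1 < s k * (1 + norm (v k))" using s[of k] by (simp only: distrib_left)
    then show "0 < t k" "t k < 1" by (simp_all add: t_def)
  qed
  define z where "z k = (1 - t k) *\<^sub>R w k + t k *\<^sub>R v k" for k
  have near: "norm (z k - w k) \<le> (1 + norm (w k)) * (1 / s k)" for k
  proof -
    have "z k - w k = t k *\<^sub>R (v k - w k)" by (simp add: z_def algebra_simps)
    then have "norm (z k - w k) = t k * norm (v k - w k)" using t(1)[of k] by simp
    also have "\<dots> \<le> t k * (norm (v k) + norm (w k))"
      using t(1)[of k] by (intro mult_left_mono norm_triangle_ineq4) simp
    also have "\<dots> \<le> t k * ((1 + norm (w k)) * (1 + norm (v k)))"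
      using t(1)[of k] by (intro mult_left_mono) (auto simp: algebra_simps)
    also have "\<dots> = (1 + norm (w k)) * (1 / s k)"
      using pos[of k] s[of k] by (simp add: t_def)
    finally show ?thesis .
  qed
  have lim: "(\<lambda>k. (1 + norm (w k)) * (1 / s k)) \<longlonglongrightarrow> (1 + norm x) * 0"
  proof (intro tendsto_mult tendsto_add tendsto_const tendsto_norm w)
    show "(\<lambda>k. 1 / s k) \<longlonglongrightarrow> 0" 
      unfolding s_def
      by (intro tendsto_divide_0[OF tendsto_const] filterlim_at_top_imp_at_infinity sqrt_shift_at_top)
  qed
  have "(\<lambda>k. z k - w k) \<longlonglongrightarrow> 0"
    by (rule Lim_null_comparison[OF always_eventually lim[unfolded mult_zero_right]])
       (use near in blast)
  then have "z \<longlonglongrightarrow> x"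
    using tendsto_add[OF _ w(1), of "\<lambda>k. z k - w k" 0] by simp
  moreover have "g k (z k) \<le> ereal (\<bar>c\<bar> - sqrt (real (k + 2)))" for k
  proof -
    have "g k (z k) \<le> ereal (1 - t k) * g k (w k) + ereal (t k) * g k (v k)"
      using convex[of k] t[of k] unfolding convex_functional_def z_def by blast
    \<comment> \<open>Passing from \<open>c\<close> to its absolute value ensures that dropping the
      factor \<open>1 - t k\<close> later only enlarges the term.\<close>
    also have "\<dots> \<le> ereal (1 - t k) * ereal \<bar>c\<bar> +
        ereal (t k) * ereal (- (real (k + 2) * (1 + norm (v k))))"
    proof (intro add_mono ereal_mult_left_mono)
      show "g k (w k) \<le> ereal \<bar>c\<bar>" using w(2)[of k] by (rule order_trans) simp
      show "g k (v k) \<le> ereal (- (real (k + 2) * (1 + norm (v k))))"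
        using v[of k] by (rule less_imp_le)
    qed (use t[of k] in auto)
    also have "\<dots> = ereal ((1 - t k) * \<bar>c\<bar> - t k * (real (k + 2) * (1 + norm (v k))))"
      by simp
    also have "\<dots> \<le> ereal (\<bar>c\<bar> - s k)"
    proof -
      have "t k * (real (k + 2) * (1 + norm (v k))) = s k"
        unfolding ss[symmetric] using pos[of k] s[of k] by (simp add: t_def)
      moreover have "(1 - t k) * \<bar>c\<bar> \<le> \<bar>c\<bar>"
        using t[of k] by (intro mult_left_le_one_le) auto
      ultimately show ?thesis by simp
    qed
    finally show ?thesis by (simp add: s_def)
  qed
  ultimately show ?thesis using that by blast
qed

text \<open>A level \<open>m\<close> strictly below \<open>g x\<close> would bound \<open>g\<close>
  from below on a whole neighbourhood. The filter \<open>at x\<close> omits \<open>x\<close> itself,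
  and the choice of \<open>m\<close> covers terms of the sequence equal to \<open>x\<close>.\<close>

lemma lsc_sequentially_bounded_below:
  fixes g :: "'a::metric_space \<Rightarrow> ereal"
  assumes "lsc_functional g" "z \<longlonglongrightarrow> x" "\<And>k. g (z k) \<le> a k" "a \<longlonglongrightarrow> -\<infinity>"
  shows "g x = -\<infinity>"
proof (rule ccontr)
  assume "g x \<noteq> -\<infinity>"
  then have "-\<infinity> < g x" by simp
  then obtain m where m: "ereal m < g x" using ereal_dense2 by blast
  also have "g x \<le> Liminf (at x) g" using assms(1) by (simp add: lsc_functional_def)
  finally have "eventually (\<lambda>y. ereal m < g y) (at x)" by (rule less_LiminfD)
  then have "eventually (\<lambda>y. ereal m < g y) (nhds x)"
    using m by (auto simp: eventually_at_filter elim!: eventually_mono)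
  then have "eventually (\<lambda>k. ereal m < g (z k)) sequentially"
    using assms(2) unfolding filterlim_iff by blast
  moreover have "eventually (\<lambda>k. a k < ereal m) sequentially"
    using order_tendstoD(2)[OF assms(4), of "ereal m"] by simp
  ultimately have "eventually (\<lambda>k. False) sequentially"
    by eventually_elim (use assms(3) in \<open>metis leD le_less_trans less_imp_le less_le_trans\<close>)
  then show False by simp
qed

text \<open>The escape argument for one functional, with a constant sequence at a point of the
  domain and lower semicontinuity in place of the Mosco liminf inequality. It serves the indices
  before the uniform tail.\<close>

lemma convex_lsc_linear_lower_bound:
  fixes g :: "'a::real_normed_vector \<Rightarrow> ereal"
  assumes g: "proper_functional g" "lsc_functional g" "convex_functional g"
  obtains C where "\<And>v. ereal (- (C * (1 + norm v))) \<le> g v"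
proof -
  obtain w where w: "g w \<noteq> \<infinity>" and "g w \<noteq> -\<infinity>"
    using g(1) by (auto simp: proper_functional_def)
  then obtain c where c: "g w = ereal c" by (cases "g w") auto
  have "\<exists>k. \<forall>v. ereal (- (real (k + 2) * (1 + norm v))) \<le> g v"
  proof (rule ccontr)
    assume "\<not> ?thesis"
    then have "\<forall>k. \<exists>v. g v < ereal (- (real (k + 2) * (1 + norm v)))"
      by (simp add: not_le)
    then obtain v where v: "\<And>k. g (v k) < ereal (- (real (k + 2) * (1 + norm (v k))))"
      by metis
    obtain z where "z \<longlonglongrightarrow> w" "\<And>k. g (z k) \<le> ereal (\<bar>c\<bar> - sqrt (real (k + 2)))"
      using convex_escape[of "\<lambda>_. g" "\<lambda>_. w" w c v, OF g(3) tendsto_const _ v] c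
      by auto
    then have "g w = -\<infinity>"
      using lsc_sequentially_bounded_below[OF g(2) _ _ escape_tendsto] by blast
    then show False using c by simp
  qed
  then show ?thesis using that by blast
qed

text \<open>If no bound held on any tail, every level \<open>k\<close> would be violated at
  arbitrarily late indices; the escaping points along such a subsequence contradict properness of
  \<open>f0\<close>. The finitely many remaining indices have individual bounds.\<close>

lemma mosco_linear_lower_bound:
  fixes f :: "nat \<Rightarrow> 'a::real_normed_vector \<Rightarrow> ereal"
  assumes f: "\<And>n. proper_functional (f n)" "\<And>n. lsc_functional (f n)" "\<And>n. convex_functional (f n)"
    and f0: "proper_functional f0" and mosco: "mosco_converges f f0"
  obtains C where "C > 0" "\<And>n v. ereal (- (C * (1 + norm v))) \<le> f n v"
proof -
  have "\<exists>k m. \<forall>n>m. \<forall>v. ereal (- (real (k + 2) * (1 + norm v))) \<le> f n v"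
  proof (rule ccontr)
    assume "\<not> ?thesis"
    then have ex: "\<exists>n>m. \<exists>v. f n v < ereal (- (real (k + 2) * (1 + norm v)))" for k m
      by (simp add: not_le)
    obtain x where x: "f0 x \<noteq> \<infinity>" "f0 x \<noteq> -\<infinity>"
      using f0 by (auto simp: proper_functional_def)
    then obtain c0 where c0: "f0 x = ereal c0" by (cases "f0 x") auto
    obtain w where w: "w \<longlonglongrightarrow> x" "limsup (\<lambda>n. f n (w n)) \<le> f0 x"
      using mosco unfolding mosco_converges_def by blast
    then have "limsup (\<lambda>n. f n (w n)) < ereal (c0 + 1)"
      using c0 by (simp add: le_less_trans)
    then have "eventually (\<lambda>n. f n (w n) < ereal (c0 + 1)) sequentially"
      by (rule Limsup_lessD)
    then obtain m0 where m0: "\<And>n. n \<ge> m0 \<Longrightarrow> f n (w n) < ereal (c0 + 1)"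
      by (auto simp: eventually_sequentially)
    \<comment> \<open>Violation of level \<open>k\<close> is paired with \<open>n \<ge> m0\<close>,
      from where on the recovery sequence stays below \<open>c0 + 1\<close>.\<close>
    define Q where "Q k n \<longleftrightarrow> n \<ge> m0 \<and> (\<exists>v. f n v < ereal (- (real (k + 2) * (1 + norm v))))" for k n
    have next_n: "\<exists>n>m. Q k n" for k m
      using ex[of "max m m0" k] unfolding Q_def by (metis le_less_trans less_imp_le max.cobounded1 max.cobounded2)
    then have "\<exists>r. \<forall>k. Q k (r k) \<and> r k < r (Suc k)"
      by (intro dependent_nat_choice) blast+
    then obtain r where r: "\<And>k. Q k (r k)" "\<And>k. r k < r (Suc k)" by blast
    then have mono: "strict_mono r" by (simp add: strict_mono_Suc_iff)
    obtain v where v: "\<And>k. f (r k) (v k) < ereal (- (real (k + 2) * (1 + norm (v k))))"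
      using r(1) unfolding Q_def by metis
    have "(\<lambda>k. w (r k)) \<longlonglongrightarrow> x"
      using LIMSEQ_subseq_LIMSEQ[OF w(1) mono] by (simp add: o_def)
    moreover have "f (r k) (w (r k)) \<le> ereal (c0 + 1)" for k
      using r(1)[of k] m0[of "r k"] unfolding Q_def by (simp add: less_imp_le)
    ultimately obtain z where z: "z \<longlonglongrightarrow> x" "\<And>k. f (r k) (z k) \<le> ereal (\<bar>c0 + 1\<bar> - sqrt (real (k + 2)))"
      using convex_escape[of "\<lambda>k. f (r k)" "\<lambda>k. w (r k)" x "c0 + 1" v, OF f(3) _ _ v] by blast
    have "f0 x \<le> -\<infinity>"
      by (rule mosco_subseq_limit_le[OF mosco mono tendsto_imp_weakly_converges[OF z(1)] z(2) escape_tendsto])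
    then show False using x by simp
  qed
  then obtain k m where tail: "\<And>n v. n > m \<Longrightarrow> ereal (- (real (k + 2) * (1 + norm v))) \<le> f n v"
    by blast
  have "\<exists>C. \<forall>v. ereal (- (C * (1 + norm v))) \<le> f n v" for n
    using convex_lsc_linear_lower_bound[OF f] by metis
  then obtain C where C: "\<And>n v. ereal (- (C n * (1 + norm v))) \<le> f n v" by metis
  \<comment> \<open>A sum of absolute values majorizes the tail constant and each of the finitely
    many individual constants.\<close>
  define B where "B = real (k + 2) + (\<Sum>n\<le>m. \<bar>C n\<bar>)"
  have B: "real (k + 2) \<le> B" "\<And>n. n \<le> m \<Longrightarrow> C n \<le> B"
  proof -
    show "real (k + 2) \<le> B" by (simp add: B_def sum_nonneg)
    fix n assume "n \<le> m"
    then have "\<bar>C n\<bar> \<le> (\<Sum>n\<le>m. \<bar>C n\<bar>)" by (intro member_le_sum) auto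
    then show "C n \<le> B" by (simp add: B_def)
  qed
  show ?thesis
  proof (rule that[of B])
    show "B > 0" using B(1) by simp
    fix n v
    have "\<exists>c. c \<le> B \<and> ereal (- (c * (1 + norm v))) \<le> f n v"
      using tail[of n v] C[of n v] B by (cases "n \<le> m") (auto simp: not_le)
    then obtain c where c: "c \<le> B" "ereal (- (c * (1 + norm v))) \<le> f n v" by blast
    have "c * (1 + norm v) \<le> B * (1 + norm v)"
      using c(1) by (intro mult_right_mono) auto
    then have "ereal (- (B * (1 + norm v))) \<le> ereal (- (c * (1 + norm v)))" by simp
    then show "ereal (- (B * (1 + norm v))) \<le> f n v" using c(2) by (rule order_trans)
  qed
qed

section \<open>Near-minimizers and Mosco convergence of the regularizations\<close>

lemma near_minimizers:
  fixes f :: "nat \<Rightarrow> 'a::real_normed_vector \<Rightarrow> ereal"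
  assumes low: "\<And>n v. ereal (- (C * (1 + norm v))) \<le> f n v" and "C > 0"
    and pq: "1 < p" "1 < q" "1 / p + 1 / q = 1"
    and e: "\<And>n. 0 < e n" "\<And>n. e n \<le> 1"
    and u: "weakly_converges_to u x"
    and less: "liminf (\<lambda>n. moreau_yosida p (e n) (f n) (u n)) < ereal c"
  obtains r :: "nat \<Rightarrow> nat" and v B where "strict_mono r"
    "\<And>k. ereal (penalty p (e (r k)) (u (r k) - v k)) + f (r k) (v k) < ereal c"
    "\<And>k. norm (v k) \<le> B" "\<And>k. norm (u (r k) - v k) \<le> B"
    "\<And>k. penalty p (e (r k)) (u (r k) - v k) \<le> B"
proof -
  have "\<not> eventually (\<lambda>n. ereal c \<le> moreau_yosida p (e n) (f n) (u n)) sequentially"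
    using less Liminf_bounded[of "ereal c" "\<lambda>n. moreau_yosida p (e n) (f n) (u n)" sequentially]
    by (auto simp: not_le)
  from not_eventually_sequentiallyD[OF this]
  obtain r :: "nat \<Rightarrow> nat" where r: "strict_mono r"
    and lt: "\<And>k. moreau_yosida p (e (r k)) (f (r k)) (u (r k)) < ereal c"
    by (auto simp: not_le)
  have "\<exists>v. ereal (penalty p (e (r k)) (u (r k) - v)) + f (r k) v < ereal c" for k
    using lt[of k] unfolding moreau_yosida_penalty INF_less_iff by blast
  then obtain v where v: "\<And>k. ereal (penalty p (e (r k)) (u (r k) - v k)) + f (r k) (v k) < ereal c"
    by metis
  obtain U where "U > 0" and U: "\<And>n. norm (u n) \<le> U"
    using weakly_convergent_bounded[OF u] by blast
  \<comment> \<open>The penalty is used with slope \<open>C + 1\<close>, one more than the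
    functional can lose; the remaining slope 1 bounds the distance
    \<open>norm (u (r k) - v k)\<close> by \<open>S\<close>, uniformly in the parameter.\<close>
  define D where "D = (C + 1) powr q / q"
  define S where "S = \<bar>c + D + C * (1 + U)\<bar>"
  have bounds: "norm (u (r k) - v k) \<le> S" "norm (v k) \<le> U + S"
    "penalty p (e (r k)) (u (r k) - v k) \<le> \<bar>c\<bar> + C * (1 + U + S)" for k
  proof -
    let ?s = "norm (u (r k) - v k)" and ?P = "penalty p (e (r k)) (u (r k) - v k)"
    have nv: "norm (v k) \<le> U + ?s"
      using U[of "r k"] norm_triangle_ineq4[of "u (r k)" "u (r k) - v k"] by simp
    have "C * (1 + norm (v k)) \<le> C * (1 + U + ?s)"
      using nv \<open>C > 0\<close> by (intro mult_left_mono) auto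
    moreover have "?P < c + C * (1 + norm (v k))"
      using v[of k] low[of "v k" "r k"] by (cases "f (r k) (v k)") auto
    ultimately have P: "?P < c + C * (1 + U + ?s)" by linarith
    have "(C + 1) * ?s - D \<le> ?P"
      unfolding D_def using e[of "r k"] pq \<open>C > 0\<close> by (intro penalty_ge_linear_uniform) auto
    with P show s: "?s \<le> S" by (simp add: S_def algebra_simps)
    with nv show "norm (v k) \<le> U + S" by simp
    have "C * (1 + U + ?s) \<le> C * (1 + U + S)"
      using s \<open>C > 0\<close> by (intro mult_left_mono) auto
    with P show "?P \<le> \<bar>c\<bar> + C * (1 + U + S)" by linarith
  qed
  define B where "B = U + S + (\<bar>c\<bar> + C * (1 + U + S))"
  have "0 \<le> S" by (simp add: S_def)
  then have "0 \<le> C * (1 + U + S)" using \<open>C > 0\<close> \<open>U > 0\<close> by simp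
  then have B: "S \<le> B" "U + S \<le> B" "\<bar>c\<bar> + C * (1 + U + S) \<le> B"
    using \<open>U > 0\<close> \<open>0 \<le> S\<close> by (simp_all add: B_def)
  show ?thesis
    using that[of r v B] r v bounds B order_trans by blast
qed

text \<open>Weak lower semicontinuity of the norm makes the penalty of the limits at most the limit
  of the penalties, so the weak limit \<open>y\<close> of near-minimizers is a competitor with total
  value at most \<open>c\<close>. The recovery sequence can be taken constant.\<close>

lemma moreau_yosida_mosco:
  fixes f :: "nat \<Rightarrow> 'a::real_normed_vector \<Rightarrow> ereal"
  assumes refl: "reflexive_space TYPE('a)"
    and mosco: "mosco_converges f f0"
    and low: "\<And>n v. ereal (- (C * (1 + norm v))) \<le> f n v" and "C > 0"
    and pq: "1 < p" "1 < q" "1 / p + 1 / q = 1"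
    and \<epsilon>: "0 < \<epsilon>" "\<epsilon> \<le> 1"
  shows "mosco_converges (\<lambda>n. moreau_yosida p \<epsilon> (f n)) (moreau_yosida p \<epsilon> f0)"
  unfolding mosco_converges_def
proof (intro allI conjI impI)
  fix x and u :: "nat \<Rightarrow> 'a"
  assume u: "weakly_converges_to u x"
  show "moreau_yosida p \<epsilon> f0 x \<le> liminf (\<lambda>n. moreau_yosida p \<epsilon> (f n) (u n))"
  proof (rule ccontr)
    assume "\<not> ?thesis"
    then obtain c where c: "liminf (\<lambda>n. moreau_yosida p \<epsilon> (f n) (u n)) < ereal c"
      and cx: "ereal c < moreau_yosida p \<epsilon> f0 x"
      unfolding not_le using ereal_dense2 by blast
    obtain r :: "nat \<Rightarrow> nat" and v B where r: "strict_mono r"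
      and v: "\<And>k. ereal (penalty p \<epsilon> (u (r k) - v k)) + f (r k) (v k) < ereal c"
      and B: "\<And>k. norm (v k) \<le> B" "\<And>k. norm (u (r k) - v k) \<le> B"
      using near_minimizers[where e = "\<lambda>_. \<epsilon>", OF low \<open>C > 0\<close> pq \<epsilon> u c] by metis
    obtain r1 y where r1: "strict_mono r1" and y: "weakly_converges_to (\<lambda>k. v (r1 k)) y"
      by (rule reflexive_weakly_sequentially_compact[where x = v and B = B, OF refl B(1)])
    \<comment> \<open>Weak convergence does not make the distances converge, so a further
      subsequence is extracted; their limit \<open>s\<close> gives an exact limit of the
      penalties.\<close>
    have "bounded (range (\<lambda>k. norm (u (r (r1 k)) - v (r1 k))))"
      using B(2) by (auto simp: bounded_iff)
    from bounded_imp_convergent_subsequence[OF this] obtain s r2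
      where r2: "strict_mono (r2 :: nat \<Rightarrow> nat)"
        and s: "((\<lambda>k. norm (u (r (r1 k)) - v (r1 k))) \<circ> r2) \<longlonglongrightarrow> s" by blast
    define \<rho> where "\<rho> k = r (r1 (r2 k))" for k
    define z where "z k = v (r1 (r2 k))" for k
    have \<rho>: "strict_mono \<rho>"
      unfolding \<rho>_def using r r1 r2 by (simp add: strict_mono_def)
    have z: "weakly_converges_to z y"
      using weakly_converges_subseq[OF y r2] by (simp add: z_def[abs_def])
    have s: "(\<lambda>k. norm (u (\<rho> k) - z k)) \<longlonglongrightarrow> s"
      using s by (simp add: o_def \<rho>_def z_def)
    have "norm (x - y) \<le> s"
      by (rule norm_weak_limit_le[OF weakly_converges_diff[OF weakly_converges_subseq[OF u \<rho>] z] s])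
    then have pen: "penalty p \<epsilon> (x - y) \<le> \<epsilon> powr (1 - p) / p * s powr p"
      using \<epsilon> pq by (intro penalty_mono) auto
    have "f0 y \<le> ereal (c - \<epsilon> powr (1 - p) / p * s powr p)"
    proof (rule mosco_subseq_limit_le[OF mosco \<rho> z])
      show "f (\<rho> k) (z k) \<le> ereal (c - penalty p \<epsilon> (u (\<rho> k) - z k))" for k
        using v[of "r1 (r2 k)"] unfolding \<rho>_def z_def
        by (cases "f (r (r1 (r2 k))) (v (r1 (r2 k)))") auto
      have "(\<lambda>k. c - penalty p \<epsilon> (u (\<rho> k) - z k)) \<longlonglongrightarrow> c - \<epsilon> powr (1 - p) / p * s powr p"
        using \<epsilon> pq s by (intro tendsto_diff tendsto_const tendsto_penalty) auto
      then show "(\<lambda>k. ereal (c - penalty p \<epsilon> (u (\<rho> k) - z k))) \<longlonglongrightarrow>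
          ereal (c - \<epsilon> powr (1 - p) / p * s powr p)" by simp
    qed
    then have "ereal (penalty p \<epsilon> (x - y)) + f0 y \<le> ereal c"
      using pen by (cases "f0 y") auto
    then have "moreau_yosida p \<epsilon> f0 x \<le> ereal c"
      using moreau_yosida_le[of p \<epsilon> f0 x y] by (rule order_trans[rotated])
    then show False using cx by simp
  qed
next
  fix x :: 'a
  \<comment> \<open>Each competitor \<open>v\<close> in the limit problem is approximated by its
    recovery sequence, used as a competitor at the fixed point \<open>x\<close>; the bound then
    passes to the infimum over \<open>v\<close>.\<close>
  have "limsup (\<lambda>n. moreau_yosida p \<epsilon> (f n) x) \<le> moreau_yosida p \<epsilon> f0 x"
    unfolding moreau_yosida_penalty[of p \<epsilon> f0 x]
  proof (rule INF_greatest)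
    fix v
    obtain w where w: "w \<longlonglongrightarrow> v" "limsup (\<lambda>n. f n (w n)) \<le> f0 v"
      using mosco unfolding mosco_converges_def by blast
    have "(\<lambda>n. penalty p \<epsilon> (x - w n)) \<longlonglongrightarrow> \<epsilon> powr (1 - p) / p * norm (x - v) powr p"
      using \<epsilon> pq w(1) by (intro tendsto_penalty tendsto_norm tendsto_diff tendsto_const) auto
    then have pen: "(\<lambda>n. ereal (penalty p \<epsilon> (x - w n))) \<longlonglongrightarrow> ereal (penalty p \<epsilon> (x - v))"
      using \<epsilon> by (simp add: penalty_eq)
    have "limsup (\<lambda>n. moreau_yosida p \<epsilon> (f n) x) \<le>
        limsup (\<lambda>n. ereal (penalty p \<epsilon> (x - w n)) + f n (w n))"
      by (intro Limsup_mono always_eventually allI moreau_yosida_le)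
    also have "\<dots> = ereal (penalty p \<epsilon> (x - v)) + limsup (\<lambda>n. f n (w n))"
      by (intro ereal_limsup_lim_add[OF pen]) simp
    also have "\<dots> \<le> ereal (penalty p \<epsilon> (x - v)) + f0 v"
      using w(2) by (intro add_left_mono)
    finally show "limsup (\<lambda>n. moreau_yosida p \<epsilon> (f n) x) \<le> ereal (penalty p \<epsilon> (x - v)) + f0 v" .
  qed
  then show "\<exists>w. w \<longlonglongrightarrow> x \<and> limsup (\<lambda>n. moreau_yosida p \<epsilon> (f n) (w n)) \<le> moreau_yosida p \<epsilon> f0 x"
    by (intro exI[of _ "\<lambda>_. x"]) simp
qed

lemma moreau_yosida_vanishing_mosco:
  fixes f :: "nat \<Rightarrow> 'a::real_normed_vector \<Rightarrow> ereal"
  assumes mosco: "mosco_converges f f0"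
    and low: "\<And>n v. ereal (- (C * (1 + norm v))) \<le> f n v" and "C > 0"
    and pq: "1 < p" "1 < q" "1 / p + 1 / q = 1"
    and e: "\<And>n. 0 < e n" "\<And>n. e n \<le> 1" "e \<longlonglongrightarrow> 0"
  shows "mosco_converges (\<lambda>n. moreau_yosida p (e n) (f n)) f0"
  unfolding mosco_converges_def
proof (intro allI conjI impI)
  fix x and u :: "nat \<Rightarrow> 'a"
  assume u: "weakly_converges_to u x"
  show "f0 x \<le> liminf (\<lambda>n. moreau_yosida p (e n) (f n) (u n))"
  proof (rule ccontr)
    assume "\<not> ?thesis"
    then obtain c where c: "liminf (\<lambda>n. moreau_yosida p (e n) (f n) (u n)) < ereal c"
      and cx: "ereal c < f0 x"
      unfolding not_le using ereal_dense2 by blast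
    obtain r :: "nat \<Rightarrow> nat" and v B where r: "strict_mono r"
      and v: "\<And>k. ereal (penalty p (e (r k)) (u (r k) - v k)) + f (r k) (v k) < ereal c"
      and B: "\<And>k. penalty p (e (r k)) (u (r k) - v k) \<le> B"
      using near_minimizers[where e = e, OF low \<open>C > 0\<close> pq e(1,2) u c] by metis
    define s where "s k = norm (u (r k) - v k)" for k
    have er: "(\<lambda>k. e (r k)) \<longlonglongrightarrow> 0"
      using LIMSEQ_subseq_LIMSEQ[OF e(3) r] by (simp add: o_def)
    \<comment> \<open>The penalty carries the factor \<open>e (r k) powr (1 - p) / p\<close>.
      Multiplying its bound \<open>B\<close> by the reciprocal leaves a positive power of
      \<open>e (r k)\<close>, which tends to 0.\<close>
    have sp: "s k powr p \<le> p * B * e (r k) powr (p - 1)" for k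
    proof -
      let ?a = "e (r k) powr (p - 1)" and ?b = "e (r k) powr (1 - p)"
      have one: "?a * ?b = 1"
        using e(1)[of "r k"] by (simp flip: powr_add)
      have "s k powr p = (?a * ?b) * s k powr p"
        unfolding one by simp
      also have "\<dots> = (p * ?a) * (?b / p * s k powr p)"
        using pq(1) by simp
      also have "\<dots> \<le> (p * ?a) * B"
        using B[of k] e(1) pq(1) by (intro mult_left_mono) (auto simp: penalty_eq s_def)
      finally show ?thesis by (simp add: mult_ac)
    qed
    have "(\<lambda>k. e (r k) powr (p - 1)) \<longlonglongrightarrow> 0"
      using pq(1) e(1) by (intro tendsto_zero_powrI[OF er tendsto_const])
        (auto simp: less_imp_le)
    then have "(\<lambda>k. p * B * e (r k) powr (p - 1)) \<longlonglongrightarrow> 0"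
      by (rule tendsto_mult_right_zero)
    then have lim: "(\<lambda>k. s k powr p) \<longlonglongrightarrow> 0"
      by (rule tendsto_sandwich[OF _ _ tendsto_const, rotated 2])
         (use sp in \<open>auto intro!: always_eventually\<close>)
    have "(\<lambda>k. (s k powr p) powr (1 / p)) \<longlonglongrightarrow> 0"
      by (rule tendsto_zero_powrI[OF lim tendsto_const]) (use pq(1) in auto)
    then have "s \<longlonglongrightarrow> 0"
      using pq(1) by (simp add: powr_powr s_def[abs_def])
    then have "(\<lambda>k. u (r k) - v k) \<longlonglongrightarrow> 0"
      unfolding s_def by (rule tendsto_norm_zero_cancel)
    then have "weakly_converges_to (\<lambda>k. u (r k) - v k) 0"
      by (rule tendsto_imp_weakly_converges)
    from weakly_converges_diff[OF weakly_converges_subseq[OF u r] this]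
    have "weakly_converges_to v x" by simp
    moreover have "f (r k) (v k) \<le> ereal c" for k
      using v[of k] penalty_nonneg[OF e(1)[of "r k"], of p "u (r k) - v k"] pq(1)
      by (cases "f (r k) (v k)") auto
    ultimately have "f0 x \<le> ereal c"
      by (rule mosco_subseq_limit_le[OF mosco r _ _ tendsto_const])
    then show False using cx by simp
  qed
next
  fix x :: 'a
  obtain w where w: "w \<longlonglongrightarrow> x" "limsup (\<lambda>n. f n (w n)) \<le> f0 x"
    using mosco unfolding mosco_converges_def by blast
  \<comment> \<open>The point itself is a competitor with zero penalty, so recovery sequences of
    \<open>f\<close> remain recovery sequences.\<close>
  have "moreau_yosida p (e n) (f n) (w n) \<le> f n (w n)" for n
    using moreau_yosida_le[of p "e n" "f n" "w n" "w n"] by (simp add: zero_ereal_def[symmetric])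
  then have "limsup (\<lambda>n. moreau_yosida p (e n) (f n) (w n)) \<le> limsup (\<lambda>n. f n (w n))"
    by (intro Limsup_mono always_eventually allI)
  with w show "\<exists>w. w \<longlonglongrightarrow> x \<and> limsup (\<lambda>n. moreau_yosida p (e n) (f n) (w n)) \<le> f0 x"
    using order_trans by blast
qed

section \<open>Assembly of the four assertions\<close>

theorem theorem2p3:
  fixes f :: "nat \<Rightarrow> 'a::banach \<Rightarrow> ereal" and f0 :: "'a \<Rightarrow> ereal"
    and \<epsilon> p q :: real
  assumes "reflexive_space TYPE('a)"
    and "\<And>n. proper_functional (f n)"
    and "\<And>n. lsc_functional (f n)"
    and "\<And>n. convex_functional (f n)"
    and "proper_functional f0"
    and "\<And>N. N > 0 \<Longrightarrow> superlinear_upto N (\<lambda>n. convex_conjugate (f n))"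
    and "\<And>N. N > 0 \<Longrightarrow> superlinear_upto N f"
    and "mosco_converges f f0"
    and "0 < \<epsilon>" and "\<epsilon> \<le> 1"
    and "p > 1" and "q > 1" and "1 / p + 1 / q = 1"
  shows "((\<forall>N>0. superlinear_upto N (\<lambda>n. convex_conjugate (moreau_yosida p \<epsilon> (f n))) \<and>
                 superlinear_upto N (\<lambda>n. moreau_yosida p \<epsilon> (f n))) \<and>
          mosco_converges (\<lambda>n. moreau_yosida p \<epsilon> (f n)) (moreau_yosida p \<epsilon> f0)) \<and>
         (\<forall>n \<xi>. convex_conjugate (moreau_yosida p \<epsilon> (f n)) \<xi> =
            ereal (\<epsilon> / q * norm \<xi> powr q) + convex_conjugate (f n) \<xi>) \<and>
         (\<forall>N>0. \<forall>M>0. \<exists>K>0. \<forall>\<delta>. 0 < \<delta> \<and> \<delta> \<le> 1 \<longrightarrow> (\<forall>n\<le>N.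
            (\<forall>v. K \<le> norm v \<longrightarrow> ereal (M * norm v) \<le> moreau_yosida p \<delta> (f n) v) \<and>
            (\<forall>\<xi>. K \<le> norm \<xi> \<longrightarrow>
               ereal (M * norm \<xi>) \<le> convex_conjugate (moreau_yosida p \<delta> (f n)) \<xi>))) \<and>
         (\<forall>e :: nat \<Rightarrow> real. (\<forall>n. 0 < e n \<and> e n \<le> 1) \<and> e \<longlonglongrightarrow> 0 \<longrightarrow>
            mosco_converges (\<lambda>n. moreau_yosida p (e n) (f n)) f0)"
proof -
  note refl = assms(1) and f = assms(2,3,4) and super = assms(6,7) and mosco = assms(8)
    and \<epsilon> = assms(9,10) and pq = assms(11,12,13)
  obtain C where C: "C > 0" "\<And>n v. ereal (- (C * (1 + norm v))) \<le> f n v"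
    using mosco_linear_lower_bound[OF f assms(5) mosco] by blast
  have conj: "convex_conjugate (moreau_yosida p \<delta> (f n)) \<xi> =
      ereal (\<delta> / q * norm \<xi> powr q) + convex_conjugate (f n) \<xi>" if "0 < \<delta>" for n \<delta> \<xi>
    using f(1) that pq by (rule convex_conjugate_moreau_yosida)
  \<comment> \<open>Assertion (3) comes first, since its instance with parameter \<epsilon> yields
    both superlinearity claims of (1).\<close>
  have uniform: "\<exists>K>0. \<forall>\<delta>. 0 < \<delta> \<and> \<delta> \<le> 1 \<longrightarrow> (\<forall>n\<le>N.
      (\<forall>v. K \<le> norm v \<longrightarrow> ereal (M * norm v) \<le> moreau_yosida p \<delta> (f n) v) \<and>
      (\<forall>\<xi>. K \<le> norm \<xi> \<longrightarrow>
         ereal (M * norm \<xi>) \<le> convex_conjugate (moreau_yosida p \<delta> (f n)) \<xi>))"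
    if "N > 0" "M > 0" for N M
  proof -
    obtain K1 where K1: "K1 > 0" "\<And>\<delta> n v. 0 < \<delta> \<Longrightarrow> \<delta> \<le> 1 \<Longrightarrow> n \<le> N \<Longrightarrow> K1 \<le> norm v \<Longrightarrow>
        ereal (M * norm v) \<le> moreau_yosida p \<delta> (f n) v"
      using moreau_yosida_superlinear[OF super(2)[OF \<open>N > 0\<close>] C(2,1) pq \<open>M > 0\<close>] by metis
    obtain K2 where K2: "\<And>n \<xi>. n \<le> N \<Longrightarrow> K2 \<le> norm \<xi> \<Longrightarrow>
        ereal (M * norm \<xi>) \<le> convex_conjugate (f n) \<xi>"
      using superlinear_uptoD[OF super(1)[OF \<open>N > 0\<close>], of M] by metis
    \<comment> \<open>By the conjugate formula the regularization only adds a nonnegative term, so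
      the threshold \<open>K2\<close> of the original conjugates works for every
      \<open>\<delta>\<close>.\<close>
    have "ereal (M * norm \<xi>) \<le> convex_conjugate (moreau_yosida p \<delta> (f n)) \<xi>"
      if "0 < \<delta>" "n \<le> N" "K2 \<le> norm \<xi>" for \<delta> n \<xi>
    proof -
      have "0 + ereal (M * norm \<xi>) \<le> ereal (\<delta> / q * norm \<xi> powr q) + convex_conjugate (f n) \<xi>"
        using that pq by (intro add_mono K2) auto
      then show ?thesis using conj[OF that(1)] by simp
    qed
    then show ?thesis
      using K1 by (intro exI[of _ "max K1 K2"]) auto
  qed
  have "superlinear_upto N (\<lambda>n. convex_conjugate (moreau_yosida p \<epsilon> (f n)))"
    "superlinear_upto N (\<lambda>n. moreau_yosida p \<epsilon> (f n))" if "N > 0" for N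
    using uniform[OF that] \<epsilon> by (meson superlinear_uptoI)+
  moreover have "mosco_converges (\<lambda>n. moreau_yosida p \<epsilon> (f n)) (moreau_yosida p \<epsilon> f0)"
    using refl mosco C(2,1) pq \<epsilon> by (rule moreau_yosida_mosco)
  moreover have "mosco_converges (\<lambda>n. moreau_yosida p (e n) (f n)) f0"
    if "\<forall>n. 0 < e n \<and> e n \<le> 1" "e \<longlonglongrightarrow> 0" for e
    using that by (intro moreau_yosida_vanishing_mosco[OF mosco C(2,1) pq]) auto
  ultimately show ?thesis
    using uniform conj[OF \<epsilon>(1)] by blast
qed

end
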